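(* Let $\mathcal A=\{r_0,\dots,r_m\}\subset\mathbb Z^n$ with $\mathbb Z\mathcal A=\mathbb Z^n$ and $k\ge1$. The tropicalization $\operatorname{trop}(Y_{\mathcal A}^{(k)})\subset\mathbb R^{m+1}$ is equal to the Minkowski sum \[\operatorname{trop}(Y_{\mathcal A}^{(k)})=\operatorname{Rowspan}(A)+\operatorname{trop}(\operatorname{Ker}(A^{(k)})).\] Its image $\pi(\operatorname{trop}(Y^{(k)}_{\mathcal A}))$ in $\mathbb R^{m+1}/\!\sim$ is the tropicalization of the $k$-th dual variety $X_{\mathcal A}^{(k)}$.
   Context: $X_{\mathcal A}\subset\mathbb P^m$ is the closure of the image of $(\mathbb C^* )^n\to\mathbb P^m$, $x\mapsto(x^{r_0}:\dots:x^{r_m})$. $X^{(k)}_{\mathcal A}\subset(\mathbb P^m)^\vee$ is its $k$-th dual variety: the closure of the set of hyperplanes containing the $k$-th osculating space $\mathbb P(\operatorname{Im}j_{k,x})$ at some smooth point $x$ (where $j_{k,x}$ is Taylor expansion of linear forms to order $k$); $Y^{(k)}_{\mathcal A}\subset\mathbb C^{m+1}$ is its affine cone. $A$ is the $(n+1)\times(m+1)$ integer matrix with columns $(1,r_i)$ and $\operatorname{Rowspan}(A)$ is its real row span. $A^{(k)}$ is the $\binom{n+k}{k}\times(m+1)$ matrix whose rows, indexed by $\beta\in\mathbb N^n$ with $|\beta|\le k$, are $(r_0^\beta,\dots,r_m^\beta)$; $\operatorname{Ker}(A^{(k)})\subset\mathbb C^{m+1}$ is its kernel, a linear subvariety. For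 a variety $Y\subset\mathbb C^{m+1}$ with ideal $I$ defined over $\mathbb Q$ (trivial valuation), $\operatorname{trop}(Y)=\{w\in\mathbb R^{m+1}:\operatorname{in}_w(F)\text{ is not a monomial for every }0\ne F\in I\}$, where $\operatorname{in}_w(F)$ is the sum of the terms $F_\alpha x^\alpha$ of $F$ minimizing $\langle\alpha,w\rangle$. $\mathbb R^{m+1}/\!\sim$ is the quotient by the line $\mathbb R(1,\dots,1)$, $\pi$ the projection, and for a projective variety $X$ with affine cone $Y$, $\operatorname{trop}(X)=\pi(\operatorname{trop}(Y))$.
   Formalization: The k-th dual variety is taken as the closure of hyperplanes containing the k-th osculating space at a point of the dense torus, not at any smooth point; for k≥2 smooth boundary points where the osculating space drops in dimension can add components that make the stated equality false. *)

theory Defs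
  imports Complex_Main
begin

text \<open>A polynomial in C[x_i : i in 'i] is a finitely supported coefficient function
  on exponent vectors alpha :: 'i => nat.\<close>

definition is_poly :: "(('i::finite \<Rightarrow> nat) \<Rightarrow> complex) \<Rightarrow> bool" where
  "is_poly F \<longleftrightarrow> finite {\<alpha>. F \<alpha> \<noteq> 0}"

definition poly_eval :: "(('i::finite \<Rightarrow> nat) \<Rightarrow> complex) \<Rightarrow> ('i \<Rightarrow> complex) \<Rightarrow> complex" where
  "poly_eval F c = (\<Sum>\<alpha>\<in>{\<alpha>. F \<alpha> \<noteq> 0}. F \<alpha> * (\<Prod>i\<in>UNIV. c i ^ \<alpha> i))"

definition vanishing_ideal :: "('i::finite \<Rightarrow> complex) set \<Rightarrow> (('i \<Rightarrow> nat) \<Rightarrow> complex) set" where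
  "vanishing_ideal Y = {F. is_poly F \<and> (\<forall>y\<in>Y. poly_eval F y = 0)}"

definition zariski_closure :: "('i::finite \<Rightarrow> complex) set \<Rightarrow> ('i \<Rightarrow> complex) set" where
  "zariski_closure S = {c. \<forall>F\<in>vanishing_ideal S. poly_eval F c = 0}"

section \<open>Tropicalization (trivial valuation)\<close>

definition wdeg :: "('i::finite \<Rightarrow> real) \<Rightarrow> ('i \<Rightarrow> nat) \<Rightarrow> real" where
  "wdeg w \<alpha> = (\<Sum>i\<in>UNIV. real (\<alpha> i) * w i)"

definition initial_form :: "('i::finite \<Rightarrow> real) \<Rightarrow> (('i \<Rightarrow> nat) \<Rightarrow> complex) \<Rightarrow> (('i \<Rightarrow> nat) \<Rightarrow> complex)" where
  "initial_form w F = (\<lambda>\<alpha>. if F \<alpha> \<noteq> 0 \<and> (\<forall>\<beta>. F \<beta> \<noteq> 0 \<longrightarrow> wdeg w \<alpha> \<le> wdeg w \<beta>) then F \<alpha> else 0)"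

definition is_monomial :: "(('i::finite \<Rightarrow> nat) \<Rightarrow> complex) \<Rightarrow> bool" where
  "is_monomial G \<longleftrightarrow> (\<exists>!\<alpha>. G \<alpha> \<noteq> 0)"

definition trop :: "('i::finite \<Rightarrow> complex) set \<Rightarrow> ('i \<Rightarrow> real) set" where
  "trop Y = {w. \<forall>F\<in>vanishing_ideal Y. F \<noteq> (\<lambda>_. 0) \<longrightarrow> \<not> is_monomial (initial_form w F)}"

definition proj_class :: "('i::finite \<Rightarrow> real) \<Rightarrow> ('i \<Rightarrow> real) set" where
  "proj_class w = {(\<lambda>i. w i + t) | t. True}"

text \<open>trop of a projective variety, given via its affine cone Y.\<close>
definition trop_proj :: "('i::finite \<Rightarrow> complex) set \<Rightarrow> ('i \<Rightarrow> real) set set" where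
  "trop_proj Y = proj_class ` trop Y"

text \<open>Points r i :: nat => int with coordinates j < n (and r i j = 0 for j >= n).
  Multi-indices beta in N^n with |beta| <= k.\<close>

definition multi_idx :: "nat \<Rightarrow> nat \<Rightarrow> (nat \<Rightarrow> nat) set" where
  "multi_idx n k = {\<beta>. (\<forall>j\<ge>n. \<beta> j = 0) \<and> (\<Sum>j<n. \<beta> j) \<le> k}"

definition lattice_span :: "('i::finite \<Rightarrow> nat \<Rightarrow> int) \<Rightarrow> (nat \<Rightarrow> int) set" where
  "lattice_span r = {(\<lambda>j. \<Sum>i\<in>UNIV. a i * r i j) | a. True}"

definition Zn :: "nat \<Rightarrow> (nat \<Rightarrow> int) set" where
  "Zn n = {v. \<forall>j\<ge>n. v j = 0}"

text \<open>Rowspan(A) over R, A having columns (1, r_i).\<close>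
definition rowspan_A :: "('i::finite \<Rightarrow> nat \<Rightarrow> int) \<Rightarrow> nat \<Rightarrow> ('i \<Rightarrow> real) set" where
  "rowspan_A r n = {(\<lambda>i. a0 + (\<Sum>j<n. a j * of_int (r i j))) | a0 a. True}"

definition ker_Ak :: "('i::finite \<Rightarrow> nat \<Rightarrow> int) \<Rightarrow> nat \<Rightarrow> nat \<Rightarrow> ('i \<Rightarrow> complex) set" where
  "ker_Ak r n k = {c. \<forall>\<beta>\<in>multi_idx n k.
      (\<Sum>i\<in>UNIV. c i * of_int (\<Prod>j<n. r i j ^ \<beta> j)) = 0}"

text \<open>Falling factorial: d^b/dt^b t^a = ffact_int a b * t^(a-b).\<close>
definition ffact_int :: "int \<Rightarrow> nat \<Rightarrow> int" where
  "ffact_int a b = (\<Prod>l<b. a - int l)"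

text \<open>Partial derivative d^beta of the Laurent polynomial
  f_c(t) = sum_i c_i t^(r_i), evaluated at the torus point x.\<close>
definition deriv_lin_form :: "('i::finite \<Rightarrow> nat \<Rightarrow> int) \<Rightarrow> nat \<Rightarrow> ('i \<Rightarrow> complex)
    \<Rightarrow> (nat \<Rightarrow> nat) \<Rightarrow> (nat \<Rightarrow> complex) \<Rightarrow> complex" where
  "deriv_lin_form r n c \<beta> x =
     (\<Sum>i\<in>UNIV. c i * of_int (\<Prod>j<n. ffact_int (r i j) (\<beta> j))
                   * (\<Prod>j<n. x j powi (r i j - int (\<beta> j))))"

definition torus :: "nat \<Rightarrow> (nat \<Rightarrow> complex) set" where
  "torus n = {x. \<forall>j<n. x j \<noteq> 0}"

text \<open>The hyperplane c contains the k-th osculating space at the point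
  (x^{r_0}:...:x^{r_m}) iff the Taylor expansion to order k of the linear form c
  (pulled back along the monomial parametrization) vanishes at x.\<close>
definition osc_hyperplanes :: "('i::finite \<Rightarrow> nat \<Rightarrow> int) \<Rightarrow> nat \<Rightarrow> nat \<Rightarrow> ('i \<Rightarrow> complex) set" where
  "osc_hyperplanes r n k = {c. \<exists>x\<in>torus n. \<forall>\<beta>\<in>multi_idx n k. deriv_lin_form r n c \<beta> x = 0}"

definition dual_cone :: "('i::finite \<Rightarrow> nat \<Rightarrow> int) \<Rightarrow> nat \<Rightarrow> nat \<Rightarrow> ('i \<Rightarrow> complex) set" where
  "dual_cone r n k = zariski_closure (osc_hyperplanes r n k)"

definition trop_dual_variety :: "('i::finite \<Rightarrow> nat \<Rightarrow> int) \<Rightarrow> nat \<Rightarrow> nat \<Rightarrow> ('i \<Rightarrow> real) set set" where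
  "trop_dual_variety r n k = trop_proj (dual_cone r n k)"

end

theory Submission
  imports Defs "HOL-Analysis.Analysis" "HOL-Computational_Algebra.Polynomial"
begin

text \<open>
  By Newton's change of basis between powers and falling factorials, the osculating hyperplanes
  form the torus orbit of the rational linear space \<open>L = Ker A\<^sup>(\<^sup>k\<^sup>)\<close>.
  The inclusion of the Minkowski sum in the tropicalization holds because the vanishing ideal of the
  orbit is graded by the rows of \<open>A\<close>, and adding an element of the row span to a
  weight does not change the initial form of a homogeneous polynomial.

  Conversely, let \<open>w\<close> be in the tropicalization of the orbit and let
  \<open>c\<close> be a point of \<open>L\<close> at which only those rational polynomials vanish
  that vanish on all of \<open>L\<close>; it exists by Baire's theorem. Since no homogeneous polynomial
  vanishing on \<open>L\<close> has a monomial as \<open>w\<close>-initial form, 1 is not a rational combination of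
  monomials \<open>c\<^sup>b\<close> with \<open>A b = 0\<close> and
  \<open>\<langle>b, w\<rangle> > 0\<close>. As in Chevalley's theorem there is a valuation ring of the
  field of complex numbers that contains the inverse of none of these monomials. It preorders the coordinates
  \<open>c\<^sub>i\<close>, and Farkas' lemma turns this preorder into a real vector
  \<open>v\<close> in \<open>w + Rowspan A\<close>. Writing every \<open>c\<^sub>i\<close> in a
  rational basis \<open>c\<^sub>j\<close> adapted to the preorder and multiplying \<open>c\<^sub>j\<close>
  by \<open>t powr v\<^sub>j\<close> gives a curve in \<open>L\<close> whose coordinates
  have exact orders \<open>v\<^sub>i\<close>, so \<open>v\<close> is in the tropicalization of
  \<open>L\<close>.
\<close>

section \<open>Osculating hyperplanes\<close>

text \<open>Induction on \<open>b\<close>: with \<open>p l\<close> the product of the first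
  \<open>l\<close> factors \<open>x - a' m\<close>, the identity
  \<open>p l * (x - a b) = p (Suc l) + (a' l - a b) * p l\<close> re-expands one more factor in the
  same basis.\<close>

lemma newton_basis_change:
  fixes a a' :: "nat \<Rightarrow> int"
  shows "\<exists>s. \<forall>x. (\<Prod>l<b. x - a l) = (\<Sum>l\<le>b. s l * (\<Prod>m<l. x - a' m))"
proof (induction b)
  case 0
  then show ?case by (intro exI[of _ "\<lambda>_. 1"]) simp
next
  case (Suc b)
  then obtain s where s: "\<And>x. (\<Prod>l<b. x - a l) = (\<Sum>l\<le>b. s l * (\<Prod>m<l. x - a' m))"
    by blast
  define s' where "s' = (\<lambda>l. (if l = 0 then 0 else s (l - 1)) + (if l \<le> b then s l * (a' l - a b) else 0))"
  have "(\<Prod>l<Suc b. x - a l) = (\<Sum>l\<le>Suc b. s' l * (\<Prod>m<l. x - a' m))" for x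
  proof -
    define p where "p = (\<lambda>l. \<Prod>m<l. x - a' m)"
    have "(\<Prod>l<Suc b. x - a l) = (\<Sum>l\<le>b. s l * p l) * (x - a b)"
      by (simp add: s p_def)
    also have "\<dots> = (\<Sum>l\<le>b. s l * p (Suc l) + s l * (a' l - a b) * p l)"
      unfolding sum_distrib_right by (intro sum.cong) (simp_all add: p_def algebra_simps)
    also have "\<dots> = (\<Sum>l\<le>b. s l * p (Suc l)) + (\<Sum>l\<le>b. s l * (a' l - a b) * p l)"
      by (rule sum.distrib)
    also have "(\<Sum>l\<le>b. s l * p (Suc l)) = (\<Sum>l\<le>Suc b. (if l = 0 then 0 else s (l - 1)) * p l)"
      by (subst sum.atMost_Suc_shift) simp
    also have "(\<Sum>l\<le>b. s l * (a' l - a b) * p l) = (\<Sum>l\<le>Suc b. (if l \<le> b then s l * (a' l - a b) else 0) * p l)"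
      by simp
    finally show ?thesis
      by (simp only: s'_def p_def sum.distrib[symmetric] ring_distribs)
  qed
  then show ?case by blast
qed

text \<open>The nodes are exchanged one coordinate at a time. Expanding coordinate \<open>m\<close>
  replaces \<open>\<beta> m\<close> by exponents \<open>l \<le> \<beta> m\<close>, and
  \<open>multi_idx n k\<close> is closed under lowering an exponent. Used in both directions between
  nodes \<open>0\<close> (powers) and nodes \<open>int\<close> (falling factorials).\<close>

lemma newton_products_vanish:
  fixes a a' :: "nat \<Rightarrow> int" and r :: "'i::finite \<Rightarrow> nat \<Rightarrow> int" and d :: "'i \<Rightarrow> complex"
  assumes "\<And>\<beta>. \<beta> \<in> multi_idx n k \<Longrightarrow> (\<Sum>i\<in>UNIV. d i * of_int (\<Prod>j<n. \<Prod>l<\<beta> j. r i j - a l)) = 0"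
    and "\<beta> \<in> multi_idx n k"
  shows "(\<Sum>i\<in>UNIV. d i * of_int (\<Prod>j<n. \<Prod>l<\<beta> j. r i j - a' l)) = 0"
proof -
  \<comment> \<open>State after \<open>m\<close> exchanges: new nodes below coordinate
    \<open>m\<close>, old nodes from \<open>m\<close> on.\<close>
  define A where "A = (\<lambda>(m::nat) j. if j < m then a' else a)"
  have "m \<le> n \<Longrightarrow> \<beta> \<in> multi_idx n k \<Longrightarrow>
      (\<Sum>i\<in>UNIV. d i * of_int (\<Prod>j<n. \<Prod>l<\<beta> j. r i j - A m j l)) = 0" for m \<beta>
  proof (induction m arbitrary: \<beta>)
    case 0
    then show ?case using assms(1) by (simp add: A_def)
  next
    case (Suc m)
    then have mn: "m < n" by simp
    obtain s where s: "\<And>x. (\<Prod>l<\<beta> m. x - a' l) = (\<Sum>l\<le>\<beta> m. s l * (\<Prod>q<l. x - a q))"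
      using newton_basis_change[where b = "\<beta> m" and a = a' and a' = a] by blast
    have mem: "\<beta>(m := l) \<in> multi_idx n k" if "l \<le> \<beta> m" for l
    proof -
      have "(\<Sum>j<n. (\<beta>(m := l)) j) \<le> (\<Sum>j<n. \<beta> j)"
        by (rule sum_mono) (use that in auto)
      then show ?thesis using Suc.prems(2) mn by (auto simp: multi_idx_def)
    qed
    have expand: "(\<Prod>j<n. \<Prod>l<\<beta> j. r i j - A (Suc m) j l) =
       (\<Sum>l\<le>\<beta> m. s l * (\<Prod>j<n. \<Prod>q<(\<beta>(m := l)) j. r i j - A m j q))" for i
    proof -
      let ?R = "\<Prod>j\<in>{..<n} - {m}. \<Prod>l<\<beta> j. r i j - A m j l"
      have "(\<Prod>j<n. \<Prod>l<\<beta> j. r i j - A (Suc m) j l)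
          = (\<Prod>l<\<beta> m. r i m - a' l) * (\<Prod>j\<in>{..<n} - {m}. \<Prod>l<\<beta> j. r i j - A (Suc m) j l)"
        using mn by (subst prod.remove[of _ m]) (auto simp: A_def)
      also have "(\<Prod>j\<in>{..<n} - {m}. \<Prod>l<\<beta> j. r i j - A (Suc m) j l) = ?R"
        by (intro prod.cong) (auto simp: A_def)
      also have "(\<Prod>l<\<beta> m. r i m - a' l) * ?R = (\<Sum>l\<le>\<beta> m. s l * ((\<Prod>q<l. r i m - a q) * ?R))"
        by (simp add: s sum_distrib_right mult.assoc)
      also have "\<dots> = (\<Sum>l\<le>\<beta> m. s l * (\<Prod>j<n. \<Prod>q<(\<beta>(m := l)) j. r i j - A m j q))"
      proof (intro sum.cong refl arg_cong2[of _ _ _ _ times])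
        fix l
        have "(\<Prod>j<n. \<Prod>q<(\<beta>(m := l)) j. r i j - A m j q) =
          (\<Prod>q<l. r i m - a q) * (\<Prod>j\<in>{..<n} - {m}. \<Prod>q<(\<beta>(m := l)) j. r i j - A m j q)"
          using mn by (subst prod.remove[of _ m]) (auto simp: A_def)
        also have "(\<Prod>j\<in>{..<n} - {m}. \<Prod>q<(\<beta>(m := l)) j. r i j - A m j q) = ?R"
          by (intro prod.cong) auto
        finally show "(\<Prod>q<l. r i m - a q) * ?R = (\<Prod>j<n. \<Prod>q<(\<beta>(m := l)) j. r i j - A m j q)"
          by simp
      qed
      finally show ?thesis .
    qed
    have "(\<Sum>i\<in>UNIV. d i * of_int (\<Prod>j<n. \<Prod>l<\<beta> j. r i j - A (Suc m) j l)) =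
      (\<Sum>l\<le>\<beta> m. of_int (s l) * (\<Sum>i\<in>UNIV. d i * of_int (\<Prod>j<n. \<Prod>q<(\<beta>(m := l)) j. r i j - A m j q)))"
      unfolding expand of_int_sum of_int_mult sum_distrib_left
      by (subst sum.swap) (simp add: mult.left_commute)
    also have "\<dots> = 0"
      using Suc.IH[OF _ mem] mn by (intro sum.neutral) auto
    finally show ?case .
  qed
  from this[OF order_refl assms(2)] show ?thesis by (simp add: A_def)
qed

text \<open>Factoring out the nonzero monomial of \<open>x\<close> with exponent
  \<open>- \<beta>\<close> leaves a linear condition on \<open>c\<close> rescaled by the monomials
  of \<open>x\<close>, with products of falling factorials as coefficients.\<close>

lemma deriv_lin_form_eq:
  assumes "x \<in> torus n"
  shows "deriv_lin_form r n c \<beta> x = (\<Prod>j<n. x j powi (- int (\<beta> j))) *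
    (\<Sum>i\<in>UNIV. (c i * (\<Prod>j<n. x j powi r i j)) * of_int (\<Prod>j<n. \<Prod>l<\<beta> j. r i j - int l))"
proof -
  have "(\<Prod>j<n. x j powi (r i j - int (\<beta> j))) =
     (\<Prod>j<n. x j powi (- int (\<beta> j))) * (\<Prod>j<n. x j powi r i j)" for i
    using assms unfolding prod.distrib[symmetric]
    by (intro prod.cong) (auto simp: torus_def power_int_add[symmetric])
  then show ?thesis
    unfolding deriv_lin_form_def ffact_int_def sum_distrib_left
    by (intro sum.cong) (simp_all only: mult_ac)
qed

text \<open>Falling factorials and powers of bounded total degree impose the same linear conditions,
  so the space that the rescaled \<open>c\<close> must lie in does not depend on
  \<open>x\<close>.\<close>

lemma osc_hyperplanes_iff:
  "c \<in> osc_hyperplanes r n k \<longleftrightarrow>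
     (\<exists>x\<in>torus n. (\<lambda>i. c i * (\<Prod>j<n. x j powi r i j)) \<in> ker_Ak r n k)"
proof -
  have "(\<forall>\<beta>\<in>multi_idx n k. deriv_lin_form r n c \<beta> x = 0) \<longleftrightarrow>
      (\<lambda>i. c i * (\<Prod>j<n. x j powi r i j)) \<in> ker_Ak r n k" (is "?l = ?r") if x: "x \<in> torus n" for x
  proof -
    define d where "d = (\<lambda>i. c i * (\<Prod>j<n. x j powi r i j))"
    have nz: "(\<Prod>j<n. x j powi (- int (\<beta> j))) \<noteq> 0" for \<beta>
      using x by (auto simp: torus_def)
    have "?l \<longleftrightarrow> (\<forall>\<beta>\<in>multi_idx n k. (\<Sum>i\<in>UNIV. d i * of_int (\<Prod>j<n. \<Prod>l<\<beta> j. r i j - int l)) = 0)"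
      by (simp only: deriv_lin_form_eq[OF x] d_def mult_eq_0_iff nz simp_thms)
    also have "\<dots> \<longleftrightarrow> (\<forall>\<beta>\<in>multi_idx n k. (\<Sum>i\<in>UNIV. d i * of_int (\<Prod>j<n. \<Prod>l<\<beta> j. r i j - 0)) = 0)"
      using newton_products_vanish[of n k d r int _ "\<lambda>_. 0"]
        newton_products_vanish[of n k d r "\<lambda>_. 0" _ int] by blast
    also have "\<dots> \<longleftrightarrow> ?r"
      by (simp add: ker_Ak_def d_def)
    finally show ?thesis .
  qed
  then show ?thesis by (auto simp: osc_hyperplanes_def)
qed

section \<open>Initial forms and tropicalization\<close>

lemma vanishing_ideal_mono: "L \<subseteq> V \<Longrightarrow> vanishing_ideal V \<subseteq> vanishing_ideal L"
  by (auto simp: vanishing_ideal_def)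

lemma trop_zariski_closure: "trop (zariski_closure S) = trop S"
proof -
  have "vanishing_ideal (zariski_closure S) = vanishing_ideal S"
    by (auto simp: vanishing_ideal_def zariski_closure_def)
  then show ?thesis by (simp add: trop_def)
qed

lemma is_monomial_initial_form_iff:
  "is_monomial (initial_form w F) \<longleftrightarrow>
     (\<exists>\<alpha>. F \<alpha> \<noteq> 0 \<and> (\<forall>\<beta>. \<beta> \<noteq> \<alpha> \<longrightarrow> F \<beta> \<noteq> 0 \<longrightarrow> wdeg w \<alpha> < wdeg w \<beta>))"
  (is "?l \<longleftrightarrow> ?r")
proof
  assume ?l
  then obtain \<alpha> where a: "initial_form w F \<alpha> \<noteq> 0" "\<And>\<beta>. initial_form w F \<beta> \<noteq> 0 \<Longrightarrow> \<beta> = \<alpha>"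
    unfolding is_monomial_def Ex1_def by blast
  from a(1) have min: "F \<alpha> \<noteq> 0" "\<And>\<beta>. F \<beta> \<noteq> 0 \<Longrightarrow> wdeg w \<alpha> \<le> wdeg w \<beta>"
    by (auto simp: initial_form_def split: if_splits)
  have "wdeg w \<alpha> < wdeg w \<beta>" if "\<beta> \<noteq> \<alpha>" "F \<beta> \<noteq> 0" for \<beta>
  proof (rule ccontr)
    assume "\<not> ?thesis"
    then have "\<forall>\<gamma>. F \<gamma> \<noteq> 0 \<longrightarrow> wdeg w \<beta> \<le> wdeg w \<gamma>"
      using min(2) by (meson not_less order_trans)
    then have "initial_form w F \<beta> \<noteq> 0"
      using that(2) by (simp add: initial_form_def)
    with a that show False by blast
  qed
  with min show ?r by blast
next
  assume ?r
  then obtain \<alpha> where a: "F \<alpha> \<noteq> 0" "\<And>\<beta>. \<beta> \<noteq> \<alpha> \<Longrightarrow> F \<beta> \<noteq> 0 \<Longrightarrow> wdeg w \<alpha> < wdeg w \<beta>"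
    by blast
  have le: "wdeg w \<alpha> \<le> wdeg w \<beta>" if "F \<beta> \<noteq> 0" for \<beta>
    using a(2)[of \<beta>] that by (cases "\<beta> = \<alpha>") auto
  have "initial_form w F \<beta> \<noteq> 0 \<longleftrightarrow> \<beta> = \<alpha>" for \<beta>
    using a(1) a(2)[of \<beta>] le by (force simp: initial_form_def)
  then show ?l by (simp add: is_monomial_def)
qed

text \<open>Excluding a strict minimum among the weights amounts to giving every term a rival of no
  larger weight. All later arguments use this form.\<close>

lemma trop_iff:
  "w \<in> trop Y \<longleftrightarrow> (\<forall>F\<in>vanishing_ideal Y. \<forall>\<alpha>. F \<alpha> \<noteq> 0 \<longrightarrow>
     (\<exists>\<beta>. \<beta> \<noteq> \<alpha> \<and> F \<beta> \<noteq> 0 \<and> wdeg w \<beta> \<le> wdeg w \<alpha>))"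
  unfolding trop_def mem_Collect_eq is_monomial_initial_form_iff by (force simp: not_less)

lemma poly_eval_eq_sum:
  assumes "finite S" "{\<alpha>. F \<alpha> \<noteq> 0} \<subseteq> S"
  shows "poly_eval F y = (\<Sum>\<alpha>\<in>S. F \<alpha> * (\<Prod>i\<in>UNIV. y i ^ \<alpha> i))"
  unfolding poly_eval_def using assms by (intro sum.mono_neutral_left) auto

lemma power_int_sum:
  fixes z :: "'a::field"
  assumes "z \<noteq> 0"
  shows "z powi (\<Sum>i\<in>A. f i) = (\<Prod>i\<in>A. z powi f i)"
  by (induction A rule: infinite_finite_induct) (use assms in \<open>auto simp: power_int_add\<close>)

text \<open>For fixed \<open>y\<close> in \<open>V\<close>, evaluating \<open>F\<close> along the
  one-parameter subgroup acting on \<open>y\<close> gives a Laurent polynomial in \<open>z\<close>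
  that vanishes for all \<open>z \<noteq> 0\<close>. Its coefficients, the values at
  \<open>y\<close> of the graded parts of \<open>F\<close>, are therefore zero.\<close>

lemma homogeneous_part_in_vanishing_ideal:
  fixes \<rho> :: "'i::finite \<Rightarrow> int"
  assumes V: "\<And>y z. y \<in> V \<Longrightarrow> z \<noteq> 0 \<Longrightarrow> (\<lambda>i. z powi \<rho> i * y i) \<in> V"
    and F: "F \<in> vanishing_ideal V"
  shows "(\<lambda>\<beta>. if (\<Sum>i\<in>UNIV. int (\<beta> i) * \<rho> i) = d then F \<beta> else 0) \<in> vanishing_ideal V"
proof -
  define e where "e = (\<lambda>\<beta>::'i \<Rightarrow> nat. \<Sum>i\<in>UNIV. int (\<beta> i) * \<rho> i)"
  define S where "S = {\<beta>. F \<beta> \<noteq> 0}"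
  define F' where "F' = (\<lambda>\<beta>. if e \<beta> = d then F \<beta> else 0)"
  have fin: "finite S" using F by (auto simp: vanishing_ideal_def is_poly_def S_def)
  have "poly_eval F' y = 0" if y: "y \<in> V" for y
  proof -
    define c where "c = (\<lambda>\<beta>. F \<beta> * (\<Prod>i\<in>UNIV. y i ^ \<beta> i))"
    \<comment> \<open>The shift by \<open>N\<close> makes all exponents nonnegative, so that an
      ordinary polynomial \<open>p\<close> can be used.\<close>
    define N where "N = (\<Sum>\<beta>\<in>S. \<bar>e \<beta>\<bar>)"
    have N: "0 \<le> e \<beta> + N" if "\<beta> \<in> S" for \<beta>
      using member_le_sum[of \<beta> S "\<lambda>\<beta>. \<bar>e \<beta>\<bar>"] fin that by (auto simp: N_def)
    define p where "p = (\<Sum>\<beta>\<in>S. Polynomial.monom (c \<beta>) (nat (e \<beta> + N)))"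
    have "poly p z = 0" if z: "z \<noteq> 0" for z
    proof -
      have "(\<Prod>i\<in>UNIV. (z powi \<rho> i * y i) ^ \<beta> i) = z powi e \<beta> * (\<Prod>i\<in>UNIV. y i ^ \<beta> i)" for \<beta>
      proof -
        have "z powi e \<beta> = (\<Prod>i\<in>UNIV. (z powi \<rho> i) ^ \<beta> i)"
          unfolding e_def using z
          by (simp add: power_int_sum power_int_mult mult.commute[of "int _"])
        then show ?thesis by (simp add: power_mult_distrib prod.distrib)
      qed
      then have "(\<Sum>\<beta>\<in>S. c \<beta> * z powi e \<beta>) = poly_eval F (\<lambda>i. z powi \<rho> i * y i)"
        by (simp add: poly_eval_def S_def c_def mult_ac)
      also have "\<dots> = 0"
        using F V[OF y z] by (auto simp: vanishing_ideal_def)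
      finally have "0 = z powi N * (\<Sum>\<beta>\<in>S. c \<beta> * z powi e \<beta>)" by simp
      also have "\<dots> = (\<Sum>\<beta>\<in>S. c \<beta> * z powi (e \<beta> + N))"
        using z by (simp add: sum_distrib_left power_int_add mult_ac)
      also have "\<dots> = (\<Sum>\<beta>\<in>S. c \<beta> * z ^ nat (e \<beta> + N))"
        using N by (intro sum.cong) (auto simp: power_int_def)
      also have "\<dots> = poly p z"
        by (simp add: p_def poly_sum poly_monom)
      finally show ?thesis by simp
    qed
    then have "UNIV - {0} \<subseteq> {z. poly p z = 0}" by auto
    moreover have "infinite (UNIV - {0::complex})"
      by (simp add: infinite_UNIV_char_0)
    ultimately have "p = 0"
      using poly_roots_finite infinite_super by blast
    have "poly_eval F' y = (\<Sum>\<beta>\<in>S. F' \<beta> * (\<Prod>i\<in>UNIV. y i ^ \<beta> i))"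
      using fin by (intro poly_eval_eq_sum) (auto simp: S_def F'_def split: if_splits)
    also have "\<dots> = (\<Sum>\<beta>\<in>S. if e \<beta> = d then c \<beta> else 0)"
      by (intro sum.cong) (auto simp: F'_def c_def)
    also have "\<dots> = 0"
    proof (cases "0 \<le> d + N")
      case True
      then have "(\<Sum>\<beta>\<in>S. if e \<beta> = d then c \<beta> else 0) = coeff p (nat (d + N))"
        unfolding p_def coeff_sum coeff_monom using N
        by (intro sum.cong) (auto simp: nat_eq_iff2)
      then show ?thesis using \<open>p = 0\<close> by simp
    next
      case False
      then show ?thesis using N by (intro sum.neutral) auto
    qed
    finally show ?thesis .
  qed
  moreover have "is_poly F'"
    unfolding is_poly_def by (rule finite_subset[OF _ fin]) (auto simp: F'_def S_def split: if_splits)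
  ultimately show ?thesis by (simp add: vanishing_ideal_def F'_def e_def)
qed

text \<open>On polynomials homogeneous for all gradings \<open>\<rho> j\<close>, adding a
  combination of the \<open>\<rho> j\<close> to the weight shifts all terms equally. The homogeneous
  part of \<open>F\<close> containing \<alpha> still vanishes on \<open>V\<close>, so the rival term
  that \<open>v\<close> provides there also serves the new weight.\<close>

lemma trop_add_character:
  fixes \<rho> :: "nat \<Rightarrow> 'i::finite \<Rightarrow> int"
  assumes V: "\<And>y z j. y \<in> V \<Longrightarrow> z \<noteq> 0 \<Longrightarrow> j < m \<Longrightarrow> (\<lambda>i. z powi \<rho> j i * y i) \<in> V"
    and "L \<subseteq> V" and v: "v \<in> trop L"
  shows "(\<lambda>i. (\<Sum>j<m. a j * of_int (\<rho> j i)) + v i) \<in> trop V"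
proof (unfold trop_iff, intro ballI allI impI)
  fix F \<alpha> assume F: "F \<in> vanishing_ideal V" "F \<alpha> \<noteq> 0"
  define e where "e = (\<lambda>j (\<beta>::'i \<Rightarrow> nat). \<Sum>i\<in>UNIV. int (\<beta> i) * \<rho> j i)"
  \<comment> \<open>\<open>P l\<close> keeps the terms that agree with \<alpha> in the first
    \<open>l\<close> gradings.\<close>
  define P where "P = (\<lambda>l \<beta>. if \<forall>j<l. e j \<beta> = e j \<alpha> then F \<beta> else 0)"
  have "l \<le> m \<Longrightarrow> P l \<in> vanishing_ideal V" for l
  proof (induction l)
    case 0
    then show ?case using F by (simp add: P_def)
  next
    case (Suc l)
    have "P (Suc l) = (\<lambda>\<beta>. if (\<Sum>i\<in>UNIV. int (\<beta> i) * \<rho> l i) = e l \<alpha> then P l \<beta> else 0)"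
      by (rule ext) (auto simp: P_def e_def less_Suc_eq)
    also have "\<dots> \<in> vanishing_ideal V"
      using Suc V by (intro homogeneous_part_in_vanishing_ideal) auto
    finally show ?case .
  qed
  then have "P m \<in> vanishing_ideal L"
    using vanishing_ideal_mono[OF \<open>L \<subseteq> V\<close>] by blast
  moreover have "P m \<alpha> \<noteq> 0" using F by (simp add: P_def)
  ultimately obtain \<beta> where b: "\<beta> \<noteq> \<alpha>" "P m \<beta> \<noteq> 0" "wdeg v \<beta> \<le> wdeg v \<alpha>"
    using v unfolding trop_iff by blast
  have deg: "wdeg (\<lambda>i. (\<Sum>j<m. a j * of_int (\<rho> j i)) + v i) \<gamma> =
      (\<Sum>j<m. a j * of_int (e j \<gamma>)) + wdeg v \<gamma>" for \<gamma>
    unfolding wdeg_def e_def of_int_sum sum_distrib_left distrib_left sum.distrib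
    by (subst sum.swap) (simp add: mult_ac)
  have "\<forall>j<m. e j \<beta> = e j \<alpha>" "F \<beta> \<noteq> 0"
    using b by (auto simp: P_def split: if_splits)
  then show "\<exists>\<beta>. \<beta> \<noteq> \<alpha> \<and> F \<beta> \<noteq> 0 \<and>
      wdeg (\<lambda>i. (\<Sum>j<m. a j * of_int (\<rho> j i)) + v i) \<beta> \<le> wdeg (\<lambda>i. (\<Sum>j<m. a j * of_int (\<rho> j i)) + v i) \<alpha>"
    using b by (intro exI[of _ \<beta>]) (simp add: deg)
qed

section \<open>Tropical points from real curves\<close>

text \<open>If \<alpha> were a strict minimum, dividing the value of \<open>F\<close> at
  \<open>y t\<close> by \<open>t powr wdeg v \<alpha>\<close> and letting \<open>t\<close> tend to 0
  would leave \<open>F \<alpha>\<close> times a monomial in the nonzero \<open>l i\<close>; but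
  \<open>F\<close> vanishes along the curve.\<close>

lemma trop_of_curve:
  fixes y :: "real \<Rightarrow> 'i::finite \<Rightarrow> complex"
  assumes yL: "\<And>t. 0 < t \<Longrightarrow> y t \<in> L"
    and lim: "\<And>i. ((\<lambda>t. y t i / of_real (t powr v i)) \<longlongrightarrow> l i) (at_right 0)"
    and nz: "\<And>i. l i \<noteq> 0"
  shows "v \<in> trop L"
proof (unfold trop_iff, intro ballI allI impI, rule ccontr)
  fix F \<alpha> assume F: "F \<in> vanishing_ideal L" "F \<alpha> \<noteq> 0"
    and "\<not> (\<exists>\<beta>. \<beta> \<noteq> \<alpha> \<and> F \<beta> \<noteq> 0 \<and> wdeg v \<beta> \<le> wdeg v \<alpha>)"
  then have min: "\<And>\<beta>. \<beta> \<noteq> \<alpha> \<Longrightarrow> F \<beta> \<noteq> 0 \<Longrightarrow> wdeg v \<alpha> < wdeg v \<beta>" by force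
  define S where "S = {\<beta>. F \<beta> \<noteq> 0}"
  have fin: "finite S" using F by (auto simp: vanishing_ideal_def is_poly_def S_def)
  define g where "g = (\<lambda>t \<beta>. F \<beta> * of_real (t powr (wdeg v \<beta> - wdeg v \<alpha>)) *
      (\<Prod>i\<in>UNIV. (y t i / of_real (t powr v i)) ^ \<beta> i))"
  have zero: "(\<Sum>\<beta>\<in>S. g t \<beta>) = 0" if t: "0 < t" for t
  proof -
    have "g t \<beta> = of_real (t powr (- wdeg v \<alpha>)) * (F \<beta> * (\<Prod>i\<in>UNIV. y t i ^ \<beta> i))" for \<beta>
    proof -
      have "t powr wdeg v \<beta> = (\<Prod>i\<in>UNIV. (t powr v i) ^ \<beta> i)"
        using t by (simp add: wdeg_def powr_sum powr_power mult.commute)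
      then have "of_real (t powr wdeg v \<beta>) * (\<Prod>i\<in>UNIV. (y t i / of_real (t powr v i)) ^ \<beta> i) =
          (\<Prod>i\<in>UNIV. y t i ^ \<beta> i)"
        using t by (simp add: power_divide flip: prod.distrib)
      from this[symmetric] have "of_real (t powr (- wdeg v \<alpha>)) * (F \<beta> * (\<Prod>i\<in>UNIV. y t i ^ \<beta> i)) =
          F \<beta> * of_real (t powr wdeg v \<beta> * t powr (- wdeg v \<alpha>)) *
            (\<Prod>i\<in>UNIV. (y t i / of_real (t powr v i)) ^ \<beta> i)"
        by (simp only: of_real_mult mult_ac)
      then show ?thesis by (simp only: g_def flip: powr_add) simp
    qed
    then have "(\<Sum>\<beta>\<in>S. g t \<beta>) = of_real (t powr (- wdeg v \<alpha>)) * poly_eval F (y t)"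
      by (simp add: poly_eval_def S_def sum_distrib_left)
    then show ?thesis using F yL[OF t] by (simp add: vanishing_ideal_def)
  qed
  define M where "M = (\<lambda>\<beta>. \<Prod>i\<in>UNIV. l i ^ \<beta> i)"
  have "((\<lambda>t. g t \<beta>) \<longlongrightarrow> (if \<beta> = \<alpha> then F \<alpha> * M \<alpha> else 0)) (at_right 0)" if "\<beta> \<in> S" for \<beta>
  proof -
    have M: "((\<lambda>t. \<Prod>i\<in>UNIV. (y t i / of_real (t powr v i)) ^ \<beta> i) \<longlongrightarrow> M \<beta>) (at_right 0)"
      unfolding M_def by (intro tendsto_prod tendsto_power lim)
    have "((\<lambda>t. t powr (wdeg v \<beta> - wdeg v \<alpha>)) \<longlongrightarrow> (if \<beta> = \<alpha> then 1 else 0)) (at_right 0)"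
    proof (cases "\<beta> = \<alpha>")
      case True
      have "eventually (\<lambda>t::real. t powr (wdeg v \<beta> - wdeg v \<alpha>) = 1) (at_right 0)"
        using eventually_at_right_less[of "0::real"] by eventually_elim (simp add: True)
      then show ?thesis using True by (simp add: tendsto_eventually)
    next
      case False
      then have "0 < wdeg v \<beta> - wdeg v \<alpha>" using min that by (simp add: S_def)
      then have "((\<lambda>t. t powr (wdeg v \<beta> - wdeg v \<alpha>)) \<longlongrightarrow> 0 powr (wdeg v \<beta> - wdeg v \<alpha>)) (at_right 0)"
        by (intro tendsto_powr2 tendsto_ident_at tendsto_const
            eventually_mono[OF eventually_at_right_less[of 0]]) auto
      then show ?thesis using False by simp
    qed
    from tendsto_mult[OF tendsto_mult[OF tendsto_const[of "F \<beta>"] tendsto_of_real[OF this]] M]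
    show ?thesis by (auto simp: g_def cong: if_cong)
  qed
  then have "((\<lambda>t. \<Sum>\<beta>\<in>S. g t \<beta>) \<longlongrightarrow> (\<Sum>\<beta>\<in>S. if \<beta> = \<alpha> then F \<alpha> * M \<alpha> else 0)) (at_right 0)"
    by (rule tendsto_sum)
  moreover have "(\<Sum>\<beta>\<in>S. if \<beta> = \<alpha> then F \<alpha> * M \<alpha> else 0) = F \<alpha> * M \<alpha>"
    using fin F by (simp add: S_def)
  moreover have "((\<lambda>t. \<Sum>\<beta>\<in>S. g t \<beta>) \<longlongrightarrow> 0) (at_right 0)"
    by (intro tendsto_eventually eventually_mono[OF eventually_at_right_less[of 0]] zero)
  ultimately have "F \<alpha> * M \<alpha> = 0"
    using tendsto_unique[of "at_right (0::real)"] by (metis trivial_limit_at_right_real)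
  then show False using F nz by (simp add: M_def)
qed

section \<open>Integral Farkas lemma\<close>

definition lin :: "('i::finite \<Rightarrow> int) \<Rightarrow> ('i \<Rightarrow> real) \<Rightarrow> real" where
  "lin b w = (\<Sum>i\<in>UNIV. of_int (b i) * w i)"

lemma lin_add_left: "lin (\<lambda>i. b i + b' i) w = lin b w + lin b' w"
  by (simp add: lin_def sum.distrib algebra_simps)

lemma lin_add_right: "lin b (\<lambda>i. w i + w' i) = lin b w + lin b w'"
  by (simp add: lin_def sum.distrib algebra_simps)

lemma lin_scale_right: "lin b (\<lambda>i. x * w i) = x * lin b w"
  by (simp add: lin_def sum_distrib_left algebra_simps)

lemma lin_of_int: "lin b (\<lambda>i. of_int (c i)) = of_int (\<Sum>i\<in>UNIV. b i * c i)"
  by (simp add: lin_def)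

lemma exists_between_finite:
  fixes l u :: "'a \<Rightarrow> real"
  assumes "finite X" "finite Y" "\<And>x y. x \<in> X \<Longrightarrow> y \<in> Y \<Longrightarrow> l x \<le> u y"
  obtains a where "\<And>x. x \<in> X \<Longrightarrow> l x \<le> a" "\<And>y. y \<in> Y \<Longrightarrow> a \<le> u y"
proof (cases "X = {}")
  case True
  show thesis
  proof (cases "Y = {}")
    case False
    then show thesis using True assms by (intro that[of "Min (u ` Y)"]) auto
  qed (use True that in auto)
next
  case False
  then show thesis using assms by (intro that[of "Max (l ` X)"]) auto
qed

text \<open>Fourier--Motzkin elimination: eliminating one row at a time only ever forms combinations
  with positive integer coefficients, so the certificates stay in the semigroup \<open>N\<close>
  although \<open>w\<close> is real.\<close>

lemma farkas_integral:
  fixes \<rho> :: "nat \<Rightarrow> 'i::finite \<Rightarrow> int" and w :: "'i \<Rightarrow> real"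
  assumes add: "\<And>b b'. b \<in> N \<Longrightarrow> b' \<in> N \<Longrightarrow> (\<lambda>i. b i + b' i) \<in> N"
    and nonneg: "\<And>b. b \<in> N \<Longrightarrow> (\<And>j. j < m \<Longrightarrow> (\<Sum>i\<in>UNIV. b i * \<rho> j i) = 0) \<Longrightarrow> 0 \<le> lin b w"
    and "finite G" "G \<subseteq> N"
  shows "\<exists>a. \<forall>g\<in>G. 0 \<le> lin g (\<lambda>i. w i + (\<Sum>j<m. a j * of_int (\<rho> j i)))"
  using nonneg \<open>finite G\<close> \<open>G \<subseteq> N\<close> add
proof (induction m arbitrary: G N)
  case 0
  then show ?case by auto
next
  case (Suc m)
  note add = Suc.prems(4)
  define e where "e = (\<lambda>b. \<Sum>i\<in>UNIV. b i * \<rho> m i)"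
  have lin_e: "lin b (\<lambda>i. of_int (\<rho> m i)) = of_int (e b)" for b
    by (simp add: lin_of_int e_def)
  have e_comb: "e (\<lambda>i. p * b i + q * b' i) = p * e b + q * e b'" for p q b b'
    by (simp add: e_def sum_distrib_left sum.distrib algebra_simps)
  have e_add: "e (\<lambda>i. b i + b' i) = e b + e b'" for b b'
    by (simp add: e_def sum.distrib algebra_simps)
  have scale: "(\<lambda>i. p * b i) \<in> N" if "b \<in> N" "0 < p" for b p
    using \<open>0 < p\<close>
  proof (induction p rule: int_gr_induct)
    case base
    then show ?case using that by simp
  next
    case (step p)
    then show ?case using add[OF step(2) that(1)] by (simp add: algebra_simps)
  qed
  define X where "X = {g \<in> G. 0 < e g}"
  define Y where "Y = {g \<in> G. e g < 0}"
  \<comment> \<open>The multipliers \<open>- e h\<close> and \<open>e g\<close> are positive for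
    \<open>g\<close> in \<open>X\<close> and \<open>h\<close> in \<open>Y\<close>, and they cancel
    the pairing with row \<open>m\<close>.\<close>
  define comb where "comb = (\<lambda>(g, h). \<lambda>i. (- e h) * g i + e g * h i :: int)"
  define G' where "G' = {g \<in> G. e g = 0} \<union> comb ` (X \<times> Y)"
  \<comment> \<open>Inside \<open>N'\<close> orthogonality to row \<open>m\<close> is built in, so
    the hypothesis for \<open>Suc m\<close> rows yields the one for \<open>m\<close> rows.\<close>
  define N' where "N' = {b \<in> N. e b = 0}"
  have XYN: "X \<subseteq> N" "Y \<subseteq> N" using Suc.prems by (auto simp: X_def Y_def)
  have "\<exists>a. \<forall>g\<in>G'. 0 \<le> lin g (\<lambda>i. w i + (\<Sum>j<m. a j * of_int (\<rho> j i)))"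
  proof (rule Suc.IH)
    show "0 \<le> lin b w" if "b \<in> N'" "\<And>j. j < m \<Longrightarrow> (\<Sum>i\<in>UNIV. b i * \<rho> j i) = 0" for b
      using that Suc.prems(1)[of b] by (auto simp: N'_def e_def less_Suc_eq)
    show "finite G'" using Suc.prems by (auto simp: G'_def X_def Y_def)
    have "comb (g, h) \<in> N'" if "g \<in> X" "h \<in> Y" for g h
    proof -
      have "(\<lambda>i. (- e h) * g i) \<in> N" "(\<lambda>i. e g * h i) \<in> N"
        using that XYN scale[of g "- e h"] scale[of h "e g"] by (auto simp: X_def Y_def)
      from add[OF this] show ?thesis by (simp add: N'_def comb_def e_comb[of "- e h" g "e g" h, simplified])
    qed
    then show "G' \<subseteq> N'" using Suc.prems by (auto simp: G'_def N'_def)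
    show "(\<lambda>i. b i + b' i) \<in> N'" if "b \<in> N'" "b' \<in> N'" for b b'
      using that add by (auto simp: N'_def e_add)
  qed
  then obtain a where a: "\<And>g. g \<in> G' \<Longrightarrow> 0 \<le> lin g (\<lambda>i. w i + (\<Sum>j<m. a j * of_int (\<rho> j i)))"
    by blast
  define w' where "w' = (\<lambda>i. w i + (\<Sum>j<m. a j * of_int (\<rho> j i)))"
  have XY: "- lin g w' / of_int (e g) \<le> - lin h w' / of_int (e h)" if "g \<in> X" "h \<in> Y" for g h
  proof -
    have "0 \<le> lin (comb (g, h)) w'"
      unfolding w'_def using that by (intro a) (auto simp: G'_def)
    also have "\<dots> = - of_int (e h) * lin g w' + of_int (e g) * lin h w'"
      by (simp add: comb_def lin_def sum_distrib_left sum_subtractf sum_negf algebra_simps)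
    finally show ?thesis using that by (simp add: X_def Y_def field_simps)
  qed
  \<comment> \<open>The coefficient of row \<open>m\<close>: each \<open>g\<close> in
    \<open>X\<close> bounds it from below, each \<open>h\<close> in \<open>Y\<close> from above, and
    nonnegativity on \<open>comb (g, h)\<close> makes the bounds compatible.\<close>
  obtain x where x: "\<And>g. g \<in> X \<Longrightarrow> - lin g w' / of_int (e g) \<le> x"
    "\<And>h. h \<in> Y \<Longrightarrow> x \<le> - lin h w' / of_int (e h)"
    using exists_between_finite[of X Y "\<lambda>g. - lin g w' / of_int (e g)" "\<lambda>g. - lin g w' / of_int (e g)"]
      XY Suc.prems(2) by (auto simp: X_def Y_def)
  have split: "lin g (\<lambda>i. w i + (\<Sum>j<Suc m. (a(m := x)) j * of_int (\<rho> j i))) = lin g w' + x * of_int (e g)" for g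
  proof -
    have "(\<lambda>i. w i + (\<Sum>j<Suc m. (a(m := x)) j * of_int (\<rho> j i))) = (\<lambda>i. w' i + x * of_int (\<rho> m i))"
      by (simp add: w'_def fun_eq_iff)
    then show ?thesis by (simp only: lin_add_right lin_scale_right lin_e)
  qed
  have "0 \<le> lin g w' + x * of_int (e g)" if g: "g \<in> G" for g
  proof -
    consider "e g = 0" | "g \<in> X" | "g \<in> Y" using g by (force simp: X_def Y_def)
    then show ?thesis
    proof cases
      case 1
      then show ?thesis using a[of g] g by (simp add: G'_def w'_def)
    next
      case 2
      then show ?thesis using x(1)[of g] by (simp add: X_def field_simps)
    next
      case 3
      then show ?thesis using x(2)[of g] by (simp add: Y_def field_simps)
    qed
  qed
  then show ?case unfolding split[symmetric] by blast
qed

section \<open>Valuation rings\<close>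

text \<open>A subring together with a proper ideal of it, as in Chevalley's extension theorem, is encoded
  by the ideal alone; the ring is recovered as the ring of multipliers.\<close>

definition nonunital_subring :: "'a::field_char_0 set \<Rightarrow> bool" where
  "nonunital_subring M \<longleftrightarrow> 0 \<in> M \<and> 1 \<notin> M \<and> (\<forall>x\<in>M. \<forall>y\<in>M. x + y \<in> M \<and> x * y \<in> M)
     \<and> (\<forall>q. \<forall>x\<in>M. of_rat q * x \<in> M)"

lemma nonunital_subringD:
  assumes "nonunital_subring M"
  shows "0 \<in> M" "1 \<notin> M" "x \<in> M \<Longrightarrow> y \<in> M \<Longrightarrow> x + y \<in> M" "x \<in> M \<Longrightarrow> y \<in> M \<Longrightarrow> x * y \<in> M"
    "x \<in> M \<Longrightarrow> of_rat q * x \<in> M" "x \<in> M \<Longrightarrow> - x \<in> M" "x \<in> M \<Longrightarrow> y \<in> M \<Longrightarrow> x - y \<in> M"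
proof -
  show 0: "0 \<in> M" "1 \<notin> M" and add: "x \<in> M \<Longrightarrow> y \<in> M \<Longrightarrow> x + y \<in> M"
    and "x \<in> M \<Longrightarrow> y \<in> M \<Longrightarrow> x * y \<in> M" "x \<in> M \<Longrightarrow> of_rat q * x \<in> M" for x y q
    using assms by (auto simp: nonunital_subring_def)
  show minus: "- x \<in> M" if "x \<in> M" for x
  proof -
    have "of_rat (- 1) * x \<in> M" using assms that unfolding nonunital_subring_def by blast
    then show ?thesis by simp
  qed
  show "x \<in> M \<Longrightarrow> y \<in> M \<Longrightarrow> x - y \<in> M"
    using add[of x "- y"] minus by simp
qed

lemma nonunital_subring_sum:
  assumes "nonunital_subring M" "\<And>i. i \<in> A \<Longrightarrow> f i \<in> M"
  shows "sum f A \<in> M"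
  using assms(2) by (induction A rule: infinite_finite_induct) (auto simp: nonunital_subringD[OF assms(1)])

lemma maximal_nonunital_subring_exists:
  assumes "nonunital_subring P"
  obtains M where "nonunital_subring M" "P \<subseteq> M"
    "\<And>M'. nonunital_subring M' \<Longrightarrow> M \<subseteq> M' \<Longrightarrow> M' = M"
proof -
  define \<A> where "\<A> = {M. nonunital_subring M \<and> P \<subseteq> M}"
  have "\<exists>M\<in>\<A>. \<forall>X\<in>\<A>. M \<subseteq> X \<longrightarrow> X = M"
  proof (rule subset_Zorn_nonempty)
    show "\<A> \<noteq> {}" using assms by (auto simp: \<A>_def)
    show "\<Union>\<C> \<in> \<A>" if "\<C> \<noteq> {}" and chain: "subset.chain \<A> \<C>" for \<C>
    proof -
      have C: "\<And>X. X \<in> \<C> \<Longrightarrow> nonunital_subring X" "\<And>X. X \<in> \<C> \<Longrightarrow> P \<subseteq> X"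
        using chain by (auto simp: subset_chain_def \<A>_def)
      have "x + y \<in> \<Union>\<C> \<and> x * y \<in> \<Union>\<C>" if xy: "x \<in> \<Union>\<C>" "y \<in> \<Union>\<C>" for x y
      proof -
        obtain X Y where XY: "X \<in> \<C>" "x \<in> X" "Y \<in> \<C>" "y \<in> Y" using xy by blast
        then consider "X \<subseteq> Y" | "Y \<subseteq> X"
          using chain unfolding subset_chain_def by blast
        then obtain Z where "Z \<in> \<C>" "x \<in> Z" "y \<in> Z"
          by cases (use XY in blast)+
        then show ?thesis using nonunital_subringD(3,4)[OF C(1)[of Z]] by blast
      qed
      moreover have "0 \<in> \<Union>\<C>" using \<open>\<C> \<noteq> {}\<close> nonunital_subringD(1)[OF C(1)] by blast
      moreover have "1 \<notin> \<Union>\<C>" using nonunital_subringD(2)[OF C(1)] by blast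
      moreover have "of_rat q * x \<in> \<Union>\<C>" if "x \<in> \<Union>\<C>" for q x
        using that nonunital_subringD(5)[OF C(1)] by blast
      ultimately have "nonunital_subring (\<Union>\<C>)" by (simp add: nonunital_subring_def)
      then show ?thesis using \<open>\<C> \<noteq> {}\<close> C(2) by (auto simp: \<A>_def)
    qed
  qed
  then obtain M where "nonunital_subring M" "P \<subseteq> M" "\<And>X. X \<in> \<A> \<Longrightarrow> M \<subseteq> X \<Longrightarrow> X = M"
    by (auto simp: \<A>_def)
  then show thesis by (intro that[of M]) (auto simp: \<A>_def)
qed

text \<open>Multiplying \<open>poly g (inverse x) = 1\<close> by \<open>x ^ q\<close> and splitting
  off the constant term \<open>b\<close> of \<open>g\<close> gives
  \<open>poly R x = (1 - b) * x ^ q\<close> with \<open>degree R < q\<close>. After multiplying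
  \<open>f\<close> by \<open>1 - b\<close>, its top term can thus be replaced by
  \<open>a * x ^ (p - q) * R\<close>; adding \<open>b\<close> restores the value 1. Multiplication
  by \<open>1 - b\<close> preserves \<open>M\<close>, and \<open>1 - b\<close> is never
  inverted.\<close>

lemma nonunital_subring_degree_reduction:
  assumes M: "nonunital_subring M" and "x \<noteq> 0"
    and f: "\<And>n. coeff f n \<in> M" "poly f x = 1"
    and g: "\<And>n. coeff g n \<in> M" "poly g (inverse x) = 1"
    and "degree g \<le> degree f"
  obtains f' where "\<And>n. coeff f' n \<in> M" "poly f' x = 1" "degree f' < degree f"
proof -
  note M_simps = nonunital_subringD[OF M]
  define p where "p = degree f"
  define q where "q = degree g"
  define a where "a = coeff f p"
  define b where "b = coeff g 0"
  define R where "R = reflect_poly g - Polynomial.monom b q"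
  define f0 where "f0 = f - Polynomial.monom a p"
  have "q > 0"
  proof (rule ccontr)
    assume "\<not> 0 < q"
    then obtain c where "g = [:c:]" using degree_eq_zeroE unfolding q_def by blast
    then show False using g(1)[of 0] g(2) M_simps(2) by simp
  qed
  have "q \<le> p" using assms by (simp add: p_def q_def)
  have coeffR: "coeff R n \<in> M" for n
    using g(1) by (auto simp: R_def coeff_reflect_poly b_def intro!: M_simps)
  have coefff0: "coeff f0 n \<in> M" for n
    using f(1) by (auto simp: f0_def a_def intro!: M_simps)
  have "degree f0 < p"
    using \<open>q > 0\<close> \<open>q \<le> p\<close>
    by (intro degree_lessI) (auto simp: f0_def a_def p_def coeff_eq_0)
  have "degree R < q"
    using \<open>q > 0\<close>
    by (intro degree_lessI) (auto simp: R_def b_def q_def coeff_reflect_poly)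
  have "poly (reflect_poly g) x = x ^ q"
    using \<open>x \<noteq> 0\<close> g(2) by (simp add: poly_reflect_poly_nz q_def)
  then have R: "poly R x = (1 - b) * x ^ q"
    by (simp add: R_def poly_monom algebra_simps)
  have f0: "poly f0 x = 1 - a * x ^ p"
    using f(2) by (simp add: f0_def poly_monom)
  define f' where "f' = [:b:] + smult (1 - b) f0 + smult a (Polynomial.monom 1 (p - q) * R)"
  have "coeff f' n \<in> M" for n
  proof -
    have "(1 - b) * coeff f0 n \<in> M"
      using coefff0[of n] g(1)[of 0] by (auto simp: algebra_simps b_def intro!: M_simps)
    moreover have "coeff [:b:] n \<in> M"
      using g(1)[of 0] by (auto simp: coeff_pCons b_def split: nat.split intro!: M_simps)
    moreover have "a * coeff (Polynomial.monom 1 (p - q) * R) n \<in> M"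
      using coeffR f(1)[of p] by (auto simp: coeff_monom_mult a_def intro!: M_simps)
    ultimately show ?thesis
      unfolding f'_def coeff_add coeff_smult by (intro M_simps(3))
  qed
  moreover have "poly f' x = 1"
  proof -
    have "x ^ (p - q) * x ^ q = x ^ p"
      using \<open>q \<le> p\<close> by (simp flip: power_add)
    then show ?thesis
      by (simp add: f'_def f0 R poly_monom algebra_simps)
  qed
  moreover have "degree f' < p"
  proof -
    have "degree (Polynomial.monom 1 (p - q) * R) \<le> (p - q) + degree R"
      by (rule order_trans[OF degree_mult_le]) (simp add: degree_monom_le)
    then have "degree (smult a (Polynomial.monom 1 (p - q) * R)) < p"
      using \<open>degree R < q\<close> \<open>q \<le> p\<close> degree_smult_le[of a "Polynomial.monom 1 (p - q) * R"] by linarith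
    moreover have "degree (smult (1 - b) f0) < p"
      using \<open>degree f0 < p\<close> degree_smult_le[of "1 - b" f0] by linarith
    ultimately show ?thesis
      using \<open>q > 0\<close> \<open>q \<le> p\<close> unfolding f'_def by (intro degree_add_less) auto
  qed
  ultimately show thesis by (intro that[of f']) (auto simp: p_def)
qed

text \<open>Infinite descent on \<open>degree f + degree g\<close>: the polynomial of larger degree
  can be reduced against the other, and the situation is symmetric under exchanging \<open>x\<close>
  with its inverse.\<close>

lemma nonunital_subring_not_both:
  assumes M: "nonunital_subring M" and "x \<noteq> 0"
    and "\<And>n. coeff f n \<in> M" "poly f x = 1"
    and "\<And>n. coeff g n \<in> M" "poly g (inverse x) = 1"
  shows False
  using assms(2-)
proof (induction "degree f + degree g" arbitrary: f g x rule: less_induct)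
  case less
  consider "degree g \<le> degree f" | "degree f \<le> degree g" by linarith
  then show ?case
  proof cases
    case 1
    obtain f' where "\<And>n. coeff f' n \<in> M" "poly f' x = 1" "degree f' < degree f"
      using nonunital_subring_degree_reduction[OF M, of x f g] less.prems 1 by blast
    then show ?thesis using less.hyps[of f' g x] less.prems by simp
  next
    case 2
    obtain g' where "\<And>n. coeff g' n \<in> M" "poly g' (inverse x) = 1" "degree g' < degree g"
      using nonunital_subring_degree_reduction[OF M, of "inverse x" g f] less.prems 2
      by (metis inverse_inverse_eq nonzero_imp_inverse_nonzero)
    then show ?thesis using less.hyps[of f g' x] less.prems by simp
  qed
qed

definition multiplier_ring :: "'a::field_char_0 set \<Rightarrow> 'a set" where
  "multiplier_ring M = {x. \<forall>y\<in>M. x * y \<in> M}"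

text \<open>Polynomials over \<open>M\<close> evaluated at \<open>z\<close> form an extension
  \<open>M'\<close> of \<open>M\<close>. If \<open>z\<close> is not a multiplier, then
  \<open>M'\<close> differs from \<open>M\<close> and maximality forces 1 into \<open>M'\<close>.
  This cannot happen for both \<open>x\<close> and its inverse.\<close>

lemma maximal_nonunital_subring_valuation:
  assumes M: "nonunital_subring M"
    and max: "\<And>M'. nonunital_subring M' \<Longrightarrow> M \<subseteq> M' \<Longrightarrow> M' = M"
    and "x \<noteq> 0"
  shows "x \<in> multiplier_ring M \<or> inverse x \<in> multiplier_ring M"
proof -
  note M_simps = nonunital_subringD[OF M]
  have *: "\<exists>f. (\<forall>n. coeff f n \<in> M) \<and> poly f z = 1" if "z \<notin> multiplier_ring M" for z
  proof (rule ccontr)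
    assume no: "\<not> ?thesis"
    define M' where "M' = {poly f z | f. \<forall>n. coeff f n \<in> M}"
    have "nonunital_subring M'"
      unfolding nonunital_subring_def
    proof (intro conjI ballI allI)
      show "0 \<in> M'" unfolding M'_def using M_simps by (auto intro!: exI[of _ 0])
      show "1 \<notin> M'" using no by (auto simp: M'_def)
      fix u assume "u \<in> M'"
      then obtain f where f: "u = poly f z" "\<And>n. coeff f n \<in> M" by (auto simp: M'_def)
      show "of_rat q * u \<in> M'" for q
        unfolding M'_def using f M_simps by (auto intro!: exI[of _ "smult (of_rat q) f"])
      fix v assume "v \<in> M'"
      then obtain g where g: "v = poly g z" "\<And>n. coeff g n \<in> M" by (auto simp: M'_def)
      show "u + v \<in> M'"
        unfolding M'_def using f g M_simps by (auto intro!: exI[of _ "f + g"])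
      show "u * v \<in> M'"
        unfolding M'_def using f g M_simps
        by (auto intro!: exI[of _ "f * g"] nonunital_subring_sum[OF M] simp: coeff_mult)
    qed
    moreover have "M \<subseteq> M'"
    proof
      fix y assume "y \<in> M"
      then have "\<forall>n. coeff [:y:] n \<in> M" using M_simps by (auto simp: coeff_pCons split: nat.split)
      then show "y \<in> M'" unfolding M'_def by (auto intro!: exI[of _ "[:y:]"])
    qed
    ultimately have "M' = M" by (rule max)
    have "z * y \<in> M" if "y \<in> M" for y
    proof -
      have "\<forall>n. coeff [:0, y:] n \<in> M" using that M_simps by (auto simp: coeff_pCons split: nat.split)
      then have "z * y \<in> M'" unfolding M'_def by (auto intro!: exI[of _ "[:0, y:]"])
      then show ?thesis by (simp add: \<open>M' = M\<close>)
    qed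
    with \<open>z \<notin> multiplier_ring M\<close> show False by (auto simp: multiplier_ring_def)
  qed
  show ?thesis
    using nonunital_subring_not_both[OF M \<open>x \<noteq> 0\<close>] *[of x] *[of "inverse x"] by blast
qed

lemma multiplier_ring:
  assumes M: "nonunital_subring M"
  shows "x \<in> multiplier_ring M \<Longrightarrow> y \<in> multiplier_ring M \<Longrightarrow> x + y \<in> multiplier_ring M"
    and "x \<in> multiplier_ring M \<Longrightarrow> y \<in> multiplier_ring M \<Longrightarrow> x * y \<in> multiplier_ring M"
    and "of_rat q \<in> multiplier_ring M"
    and "x \<in> M \<Longrightarrow> x \<noteq> 0 \<Longrightarrow> inverse x \<notin> multiplier_ring M"
proof -
  note M_simps = nonunital_subringD[OF M]
  show "x \<in> multiplier_ring M \<Longrightarrow> y \<in> multiplier_ring M \<Longrightarrow> x + y \<in> multiplier_ring M"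
    unfolding multiplier_ring_def by (auto simp: distrib_right intro: M_simps(3))
  show "x \<in> multiplier_ring M \<Longrightarrow> y \<in> multiplier_ring M \<Longrightarrow> x * y \<in> multiplier_ring M"
    unfolding multiplier_ring_def by (auto simp: mult.assoc)
  show "of_rat q \<in> multiplier_ring M"
    unfolding multiplier_ring_def by (auto intro: M_simps(5))
  assume x: "x \<in> M" "x \<noteq> 0"
  then have "inverse x * x \<notin> M" using M_simps(2) by simp
  with x show "inverse x \<notin> multiplier_ring M"
    unfolding multiplier_ring_def by blast
qed

text \<open>The elements of \<open>P\<close> lie in a maximal \<open>M\<close>, which is a proper
  ideal of its multiplier ring, so none of them is a unit there.\<close>

lemma valuation_ring_exists:
  fixes P :: "'a::field_char_0 set"
  assumes "nonunital_subring P"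
  obtains R :: "'a set" where
    "\<And>x y. x \<in> R \<Longrightarrow> y \<in> R \<Longrightarrow> x + y \<in> R" "\<And>x y. x \<in> R \<Longrightarrow> y \<in> R \<Longrightarrow> x * y \<in> R"
    "\<And>q. of_rat q \<in> R" "\<And>x. x \<noteq> 0 \<Longrightarrow> x \<in> R \<or> inverse x \<in> R"
    "\<And>x. x \<in> P \<Longrightarrow> x \<noteq> 0 \<Longrightarrow> inverse x \<notin> R"
proof -
  obtain M where M: "nonunital_subring M" "P \<subseteq> M"
    and max: "\<And>M'. nonunital_subring M' \<Longrightarrow> M \<subseteq> M' \<Longrightarrow> M' = M"
    using maximal_nonunital_subring_exists[OF assms] by blast
  show thesis
    using multiplier_ring[OF M(1)] maximal_nonunital_subring_valuation[OF M(1) max] M(2)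
    by (intro that[of "multiplier_ring M"]) blast+
qed

section \<open>Generic points of rational linear subspaces\<close>

text \<open>Lists of exponents with rational coefficients form a countable type, as Baire's theorem
  requires. Repeated exponents simply add up.\<close>

definition rat_poly_eval :: "(('i::finite \<Rightarrow> nat) \<times> rat) list \<Rightarrow> ('i \<Rightarrow> complex) \<Rightarrow> complex" where
  "rat_poly_eval ls y = (\<Sum>(\<alpha>, q)\<leftarrow>ls. of_rat q * (\<Prod>i\<in>UNIV. y i ^ \<alpha> i))"

lemma rat_poly_eval_on_line:
  "\<exists>p. \<forall>t. poly p t = rat_poly_eval ls (\<lambda>i. y i + t * d i)"
proof (induction ls)
  case Nil
  show ?case by (intro exI[of _ 0]) (simp add: rat_poly_eval_def)
next
  case (Cons m ls)
  then obtain p where p: "\<And>t. poly p t = rat_poly_eval ls (\<lambda>i. y i + t * d i)" by blast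
  obtain \<alpha> q where m: "m = (\<alpha>, q)" by force
  show ?case
    by (intro exI[of _ "smult (of_rat q) (\<Prod>i\<in>UNIV. [:y i, d i:] ^ \<alpha> i) + p"])
      (simp add: p m rat_poly_eval_def poly_prod)
qed

lemma continuous_rat_poly_eval:
  "continuous_on UNIV (\<lambda>y::complex^'i::finite. rat_poly_eval ls (($) y))"
proof (induction ls)
  case (Cons m ls)
  then show ?case
    by (cases m) (auto simp: rat_poly_eval_def intro!: continuous_intros)
qed (simp add: rat_poly_eval_def)

text \<open>Each nonempty \<open>T ls\<close> is relatively open in \<open>L\<close>, and dense
  because the polynomial has only finitely many zeros on a line through a point of
  \<open>T ls\<close>. Baire's theorem gives a point common to these countably many sets.\<close>

lemma generic_point_exists:
  fixes L :: "(complex^'i::finite) set"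
  assumes "subspace L"
  obtains c where "c \<in> L"
    "\<And>ls y. rat_poly_eval ls (($) c) = 0 \<Longrightarrow> y \<in> L \<Longrightarrow> rat_poly_eval ls (($) y) = 0"
proof -
  define T where "T = (\<lambda>ls. {y \<in> L. rat_poly_eval ls (($) y) \<noteq> 0})"
  define \<G> where "\<G> = T ` {ls. T ls \<noteq> {}}"
  have "L \<subseteq> closure (\<Inter>\<G>)"
  proof (rule Baire)
    show "closed L" using assms by (rule closed_subspace)
    show "countable \<G>" by (simp add: \<G>_def)
    fix X assume "X \<in> \<G>"
    then obtain ls where X: "X = T ls" "T ls \<noteq> {}" by (auto simp: \<G>_def)
    then obtain p where p: "p \<in> L" "rat_poly_eval ls (($) p) \<noteq> 0" by (auto simp: T_def)
    have "open ((\<lambda>y::complex^'i. rat_poly_eval ls (($) y)) -` (- {0}))"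
      by (intro open_vimage continuous_rat_poly_eval) auto
    moreover have "X = L \<inter> (\<lambda>y. rat_poly_eval ls (($) y)) -` (- {0})"
      by (auto simp: X T_def)
    ultimately have "openin (top_of_set L) X" by blast
    moreover have "y \<in> closure X" if "y \<in> L" for y
      unfolding closure_approachable
    proof (intro allI impI)
      fix e :: real assume "0 < e"
      obtain f where f: "\<And>t. poly f t = rat_poly_eval ls (\<lambda>i. y $ i + t * (p $ i - y $ i))"
        using rat_poly_eval_on_line[of ls "($) y" "\<lambda>i. p $ i - y $ i"] by blast
      have "poly f 1 \<noteq> 0" using p by (simp add: f)
      then have "finite {t. poly f t = 0}" by (intro poly_roots_finite) auto
      \<comment> \<open>The added 1 covers the case \<open>p = y\<close>.\<close>
      define \<delta> where "\<delta> = e / (norm (p - y) + 1)"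
      have "0 < \<delta>" using \<open>0 < e\<close> by (simp add: \<delta>_def add_nonneg_pos)
      then have "infinite (complex_of_real ` {0<..<\<delta>})"
        by (subst finite_image_iff) (auto intro: inj_onI)
      then have "\<not> complex_of_real ` {0<..<\<delta>} \<subseteq> {t. poly f t = 0}"
        using \<open>finite {t. poly f t = 0}\<close> finite_subset by blast
      then obtain t where t: "0 < t" "t < \<delta>" "poly f (of_real t) \<noteq> 0"
        by fastforce
      define z where "z = y + t *\<^sub>R (p - y)"
      have "z \<in> L" unfolding z_def using assms that p by (intro subspace_add subspace_scale subspace_diff)
      moreover have "(\<lambda>i. y $ i + of_real t * (p $ i - y $ i)) = ($) z"
        by (simp add: fun_eq_iff z_def scaleR_conv_of_real[where 'a = complex])
      ultimately have "z \<in> X" using t f by (simp add: X T_def)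
      moreover have "dist z y < e"
      proof -
        have "dist z y = t * norm (p - y)" using t by (simp add: z_def dist_norm)
        also have "\<dots> \<le> t * (norm (p - y) + 1)" using t by simp
        also have "\<dots> < \<delta> * (norm (p - y) + 1)"
          using t by (intro mult_strict_right_mono) (auto simp: add_nonneg_pos)
        also have "\<dots> = e"
          using add_nonneg_pos[of "norm (p - y)" 1] by (simp add: \<delta>_def)
        finally show ?thesis .
      qed
      ultimately show "\<exists>z\<in>X. dist z y < e" by blast
    qed
    ultimately show "openin (top_of_set L) X \<and> L \<subseteq> closure X" by blast
  qed
  moreover have "0 \<in> L" using assms by (rule subspace_0)
  ultimately have "\<Inter>\<G> \<noteq> {}" by fastforce
  then obtain c where c: "\<And>X. X \<in> \<G> \<Longrightarrow> c \<in> X" by blast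
  \<comment> \<open>The constant polynomial 1 makes \<open>L\<close> itself one of the sets, which
    places \<open>c\<close> in \<open>L\<close>.\<close>
  have "T [(\<lambda>_. 0, 1)] = L" by (simp add: T_def rat_poly_eval_def)
  then have "c \<in> L"
    using c[of L] \<open>0 \<in> L\<close> unfolding \<G>_def by blast
  moreover have "rat_poly_eval ls (($) y) = 0" if "rat_poly_eval ls (($) c) = 0" "y \<in> L" for ls y
    using c[of "T ls"] that by (auto simp: \<G>_def T_def)
  ultimately show thesis using that by blast
qed

section \<open>Rational bases adapted to a preorder\<close>

definition rat_independent :: "('i \<Rightarrow> 'a::field_char_0) \<Rightarrow> 'i set \<Rightarrow> bool" where
  "rat_independent c B \<longleftrightarrow>
     (\<forall>q. (\<Sum>j\<in>B. of_rat (q j) * c j) = 0 \<longrightarrow> (\<forall>j\<in>B. q j = 0))"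

lemma total_preorder_least:
  assumes "finite S" "S \<noteq> {}"
    and total: "\<And>i j. le i j \<or> le j i" and trans: "\<And>i j l. le i j \<Longrightarrow> le j l \<Longrightarrow> le i l"
  obtains i where "i \<in> S" "\<And>j. j \<in> S \<Longrightarrow> le i j"
proof -
  have "\<exists>i\<in>S. \<forall>j\<in>S. le i j"
    using assms(1,2)
  proof (induction rule: finite_ne_induct)
    case (singleton x)
    then show ?case using total by blast
  next
    case (insert x S)
    then show ?case using total trans by (metis insert_iff)
  qed
  then show thesis using that by blast
qed

lemma rat_independent_insert:
  fixes c :: "'i \<Rightarrow> 'a::field_char_0"
  assumes B: "rat_independent c B" "finite B" "i \<notin> B"
    and i: "\<And>a. c i \<noteq> (\<Sum>j\<in>B. of_rat (a j) * c j)"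
  shows "rat_independent c (insert i B)"
  unfolding rat_independent_def
proof (intro allI impI)
  fix q assume "(\<Sum>j\<in>insert i B. of_rat (q j) * c j) = 0"
  then have *: "of_rat (q i) * c i + (\<Sum>j\<in>B. of_rat (q j) * c j) = 0" using B by simp
  have "q i = 0"
  proof (rule ccontr)
    assume "q i \<noteq> 0"
    then have r: "of_rat (- inverse (q i)) = - inverse (of_rat (q i) :: 'a)" "(of_rat (q i) :: 'a) \<noteq> 0"
      by (simp_all add: of_rat_minus of_rat_inverse)
    have "c i = (\<Sum>j\<in>B. of_rat (q j) * c j) * of_rat (- inverse (q i))"
      unfolding r(1) using r(2) * by (simp add: field_simps eq_neg_iff_add_eq_0)
    also have "\<dots> = (\<Sum>j\<in>B. of_rat (q j * - inverse (q i)) * c j)"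
      unfolding sum_distrib_right of_rat_mult by (simp add: mult_ac)
    finally show False using i by metis
  qed
  then show "\<forall>j\<in>insert i B. q j = 0" using * B by (simp add: rat_independent_def)
qed

text \<open>Greedy construction from the top of the preorder down: a least \<open>i\<close> is set
  aside, the rest is treated first, and \<open>i\<close> joins the basis only if \<open>c i\<close>
  is not in its span. The order condition for \<open>i\<close> holds because \<open>i\<close> is
  least, and the expansions already found are kept.\<close>

lemma ordered_rat_basis:
  fixes c :: "'i \<Rightarrow> 'a::field_char_0"
  assumes "finite S"
    and total: "\<And>i j. le i j \<or> le j i" and trans: "\<And>i j l. le i j \<Longrightarrow> le j l \<Longrightarrow> le i l"
  shows "\<exists>B\<subseteq>S. rat_independent c B \<and>
    (\<forall>i\<in>S. \<exists>a. c i = (\<Sum>j\<in>B. of_rat (a j) * c j) \<and> (\<forall>j\<in>B. a j \<noteq> 0 \<longrightarrow> le i j))"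
  using \<open>finite S\<close>
proof (induction S rule: finite_psubset_induct)
  case (psubset S)
  show ?case
  proof (cases "S = {}")
    case True
    then show ?thesis by (auto simp: rat_independent_def)
  next
    case False
    then obtain i where i: "i \<in> S" "\<And>j. j \<in> S \<Longrightarrow> le i j"
      using total_preorder_least[of S le] psubset.hyps total trans by blast
    then have "S - {i} \<subset> S" by blast
    from psubset.IH[OF this] obtain B where B: "B \<subseteq> S - {i}" "rat_independent c B"
      "\<forall>l\<in>S - {i}. \<exists>a. c l = (\<Sum>j\<in>B. of_rat (a j) * c j) \<and> (\<forall>j\<in>B. a j \<noteq> 0 \<longrightarrow> le l j)"
      by blast
    have finB: "finite B" using B(1) psubset.hyps by (meson finite_Diff finite_subset)
    have iB: "i \<notin> B" using B by blast
    show ?thesis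
    proof (cases "\<exists>a. c i = (\<Sum>j\<in>B. of_rat (a j) * c j)")
      case True
      then have "\<exists>a. c i = (\<Sum>j\<in>B. of_rat (a j) * c j) \<and> (\<forall>j\<in>B. a j \<noteq> 0 \<longrightarrow> le i j)"
        using B i by blast
      then have "\<forall>l\<in>S. \<exists>a. c l = (\<Sum>j\<in>B. of_rat (a j) * c j) \<and> (\<forall>j\<in>B. a j \<noteq> 0 \<longrightarrow> le l j)"
        using B(3) by blast
      then show ?thesis using B by blast
    next
      case False
      let ?B = "insert i B"
      have "\<exists>a. c l = (\<Sum>j\<in>?B. of_rat (a j) * c j) \<and> (\<forall>j\<in>?B. a j \<noteq> 0 \<longrightarrow> le l j)" if l: "l \<in> S" for l
      proof (cases "l = i")
        case True
        have "(\<Sum>j\<in>B. of_rat (if j = i then 1 else 0) * c j) = 0"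
          using iB by (intro sum.neutral) auto
        then show ?thesis using True finB iB i
          by (intro exI[of _ "\<lambda>j. if j = i then 1 else 0"]) auto
      next
        case False
        then obtain a where a: "c l = (\<Sum>j\<in>B. of_rat (a j) * c j)" "\<forall>j\<in>B. a j \<noteq> 0 \<longrightarrow> le l j"
          using B(3) l by blast
        have "(\<Sum>j\<in>B. of_rat ((a(i := 0)) j) * c j) = (\<Sum>j\<in>B. of_rat (a j) * c j)"
          using iB by (intro sum.cong) auto
        then show ?thesis using a finB iB by (intro exI[of _ "a(i := 0)"]) auto
      qed
      moreover have "rat_independent c ?B"
        using rat_independent_insert[OF B(2) finB iB] False by blast
      ultimately show ?thesis using B i by (intro exI[of _ ?B]) blast
    qed
  qed
qed

section \<open>Torus orbits of linear subspaces\<close>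

definition torus_orbit :: "(nat \<Rightarrow> 'i::finite \<Rightarrow> int) \<Rightarrow> nat \<Rightarrow> ('i \<Rightarrow> complex) set \<Rightarrow> ('i \<Rightarrow> complex) set" where
  "torus_orbit \<rho> m L = {(\<lambda>i. y i * (\<Prod>j<m. s j powi \<rho> j i)) | y s. y \<in> L \<and> (\<forall>j<m. s j \<noteq> 0)}"

lemma subset_torus_orbit: "L \<subseteq> torus_orbit \<rho> m L"
proof
  fix y assume "y \<in> L"
  then show "y \<in> torus_orbit \<rho> m L"
    unfolding torus_orbit_def mem_Collect_eq by (intro exI[of _ y] exI[of _ "\<lambda>_. 1"]) simp
qed

lemma torus_orbit_stable:
  assumes "c \<in> torus_orbit \<rho> m L" "z \<noteq> 0" "j < m"
  shows "(\<lambda>i. z powi \<rho> j i * c i) \<in> torus_orbit \<rho> m L"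
proof -
  obtain y s where c: "c = (\<lambda>i. y i * (\<Prod>j<m. s j powi \<rho> j i))" "y \<in> L" "\<forall>j<m. s j \<noteq> 0"
    using assms(1) by (auto simp: torus_orbit_def)
  have "(\<Prod>l<m. (s(j := z * s j)) l powi \<rho> l i) = z powi \<rho> j i * (\<Prod>l<m. s l powi \<rho> l i)" for i
  proof -
    have "(\<Prod>l\<in>{..<m}-{j}. (s(j := z * s j)) l powi \<rho> l i) = (\<Prod>l\<in>{..<m}-{j}. s l powi \<rho> l i)"
      by (intro prod.cong) auto
    then show ?thesis
      using assms by (simp add: prod.remove[of "{..<m}" j] power_int_mult_distrib mult_ac)
  qed
  then have "(\<lambda>i. z powi \<rho> j i * c i) = (\<lambda>i. y i * (\<Prod>l<m. (s(j := z * s j)) l powi \<rho> l i))"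
    by (simp add: c mult_ac)
  moreover have "\<forall>l<m. (s(j := z * s j)) l \<noteq> 0" using c assms by auto
  ultimately show ?thesis unfolding torus_orbit_def using c(2) by blast
qed

text \<open>A polynomial of multidegree \<open>d\<close> is an eigenvector of the torus action: its
  value gets multiplied by the product of the \<open>s j powi d j\<close>.\<close>

lemma homogeneous_in_vanishing_ideal_torus_orbit:
  fixes \<rho> :: "nat \<Rightarrow> 'i::finite \<Rightarrow> int"
  assumes F: "F \<in> vanishing_ideal L"
    and hom: "\<And>\<alpha> j. F \<alpha> \<noteq> 0 \<Longrightarrow> j < m \<Longrightarrow> (\<Sum>i\<in>UNIV. int (\<alpha> i) * \<rho> j i) = d j"
  shows "F \<in> vanishing_ideal (torus_orbit \<rho> m L)"
proof -
  have "poly_eval F (\<lambda>i. y i * (\<Prod>j<m. s j powi \<rho> j i)) = 0" if "y \<in> L" and s: "\<forall>j<m. s j \<noteq> 0" for y s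
  proof -
    have "(\<Prod>i\<in>UNIV. (y i * (\<Prod>j<m. s j powi \<rho> j i)) ^ \<alpha> i) =
        (\<Prod>j<m. s j powi d j) * (\<Prod>i\<in>UNIV. y i ^ \<alpha> i)" if "F \<alpha> \<noteq> 0" for \<alpha>
    proof -
      have "(\<Prod>i\<in>UNIV. (\<Prod>j<m. s j powi \<rho> j i) ^ \<alpha> i) = (\<Prod>j<m. \<Prod>i\<in>UNIV. (s j powi \<rho> j i) ^ \<alpha> i)"
        unfolding prod_power_distrib by (rule prod.swap)
      also have "\<dots> = (\<Prod>j<m. s j powi d j)"
      proof (intro prod.cong refl)
        fix j assume "j \<in> {..<m}"
        then have j: "j < m" by simp
        show "(\<Prod>i\<in>UNIV. (s j powi \<rho> j i) ^ \<alpha> i) = s j powi d j"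
          unfolding hom[OF that j, symmetric] using s j
          by (simp add: power_int_sum power_int_mult mult.commute[of "int _"])
      qed
      finally show ?thesis by (simp add: power_mult_distrib prod.distrib)
    qed
    then have "poly_eval F (\<lambda>i. y i * (\<Prod>j<m. s j powi \<rho> j i)) = (\<Prod>j<m. s j powi d j) * poly_eval F y"
      unfolding poly_eval_def sum_distrib_left by (intro sum.cong) (simp_all add: mult_ac)
    then show ?thesis using F \<open>y \<in> L\<close> by (simp add: vanishing_ideal_def)
  qed
  then show ?thesis using F by (auto simp: vanishing_ideal_def torus_orbit_def)
qed

section \<open>Rational polynomials as lists, and Laurent monomials at a point\<close>

definition list_poly :: "(('i::finite \<Rightarrow> nat) \<times> rat) list \<Rightarrow> ('i \<Rightarrow> nat) \<Rightarrow> complex" where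
  "list_poly ls \<alpha> = (\<Sum>(\<beta>, q)\<leftarrow>ls. if \<alpha> = \<beta> then of_rat q else 0)"

lemma list_poly_support: "list_poly ls \<alpha> \<noteq> 0 \<Longrightarrow> \<alpha> \<in> fst ` set ls"
  by (induction ls) (auto simp: list_poly_def split: if_splits)

lemma is_poly_list_poly: "is_poly (list_poly ls)"
  unfolding is_poly_def by (rule finite_subset[of _ "fst ` set ls"]) (auto dest: list_poly_support)

lemma poly_eval_list_poly: "poly_eval (list_poly ls) y = rat_poly_eval ls y"
proof -
  \<comment> \<open>A fixed \<open>S\<close> containing all exponents keeps the range of summation
    constant during the induction.\<close>
  have "(\<Sum>\<alpha>\<in>S. list_poly ls \<alpha> * (\<Prod>i\<in>UNIV. y i ^ \<alpha> i)) = rat_poly_eval ls y"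
    if "finite S" "fst ` set ls \<subseteq> S" for S
    using that(2)
  proof (induction ls)
    case Nil
    then show ?case by (simp add: list_poly_def rat_poly_eval_def)
  next
    case (Cons x ls)
    obtain \<beta> q where x: "x = (\<beta>, q)" by force
    have "(\<Sum>\<alpha>\<in>S. list_poly (x # ls) \<alpha> * (\<Prod>i\<in>UNIV. y i ^ \<alpha> i)) =
        (\<Sum>\<alpha>\<in>S. if \<alpha> = \<beta> then of_rat q * (\<Prod>i\<in>UNIV. y i ^ \<beta> i) else 0) +
        (\<Sum>\<alpha>\<in>S. list_poly ls \<alpha> * (\<Prod>i\<in>UNIV. y i ^ \<alpha> i))"
      unfolding sum.distrib[symmetric] by (intro sum.cong) (auto simp: list_poly_def x distrib_right)
    also have "\<dots> = of_rat q * (\<Prod>i\<in>UNIV. y i ^ \<beta> i) + rat_poly_eval ls y"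
      using Cons \<open>finite S\<close> by (simp add: x)
    finally show ?case by (simp add: rat_poly_eval_def x)
  qed
  moreover have "{\<alpha>. list_poly ls \<alpha> \<noteq> 0} \<subseteq> fst ` set ls"
    by (auto dest: list_poly_support)
  ultimately show ?thesis
    using poly_eval_eq_sum[of "fst ` set ls" "list_poly ls" y] by simp
qed

definition laurent_monom :: "('i::finite \<Rightarrow> complex) \<Rightarrow> ('i \<Rightarrow> int) \<Rightarrow> complex" where
  "laurent_monom c b = (\<Prod>i\<in>UNIV. c i powi b i)"

lemma laurent_monom_add:
  "(\<And>i. c i \<noteq> 0) \<Longrightarrow> laurent_monom c (\<lambda>i. b i + b' i) = laurent_monom c b * laurent_monom c b'"
  by (simp add: laurent_monom_def power_int_add prod.distrib)

lemma laurent_monom_uminus: "laurent_monom c (\<lambda>i. - b i) = inverse (laurent_monom c b)"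
  by (simp add: laurent_monom_def power_int_minus prod_inversef[symmetric] o_def)

lemma laurent_monom_nonzero: "(\<And>i. c i \<noteq> 0) \<Longrightarrow> laurent_monom c b \<noteq> 0"
  by (simp add: laurent_monom_def)

definition laurent_eval :: "(('i::finite \<Rightarrow> int) \<times> rat) list \<Rightarrow> ('i \<Rightarrow> complex) \<Rightarrow> complex" where
  "laurent_eval ls c = (\<Sum>(b, q)\<leftarrow>ls. of_rat q * laurent_monom c b)"

lemma laurent_eval_simps [simp]:
  "laurent_eval [] c = 0"
  "laurent_eval ((b, q) # ls) c = of_rat q * laurent_monom c b + laurent_eval ls c"
  "laurent_eval (ls @ ls') c = laurent_eval ls c + laurent_eval ls' c"
  by (simp_all add: laurent_eval_def)

text \<open>Closure of \<open>E\<close> under addition gives closure of the rational span of its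
  monomials under products; the absence of 1 is the substantial hypothesis.\<close>

lemma laurent_span_nonunital_subring:
  assumes nz: "\<And>i. c i \<noteq> 0"
    and E: "\<And>b b'. b \<in> E \<Longrightarrow> b' \<in> E \<Longrightarrow> (\<lambda>i. b i + b' i) \<in> E"
    and one: "\<And>ls. fst ` set ls \<subseteq> E \<Longrightarrow> laurent_eval ls c \<noteq> 1"
  shows "nonunital_subring {laurent_eval ls c | ls. fst ` set ls \<subseteq> E}" (is "nonunital_subring ?P")
proof -
  have monom: "of_rat q * laurent_monom c b * laurent_eval ls c =
      laurent_eval (map (\<lambda>(b', q'). (\<lambda>i. b i + b' i, q * q')) ls) c" for b q ls
    by (induction ls) (auto simp: laurent_monom_add[OF nz] of_rat_mult algebra_simps)
  have scale: "of_rat q * laurent_eval ls c = laurent_eval (map (\<lambda>(b', q'). (b', q * q')) ls) c" for q ls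
    by (induction ls) (auto simp: of_rat_mult algebra_simps)
  have add: "x + y \<in> ?P" if xy: "x \<in> ?P" "y \<in> ?P" for x y
  proof -
    obtain ls ls' where "x = laurent_eval ls c" "y = laurent_eval ls' c" "fst ` set ls \<subseteq> E" "fst ` set ls' \<subseteq> E"
      using xy by blast
    then have "x + y = laurent_eval (ls @ ls') c" "fst ` set (ls @ ls') \<subseteq> E" by auto
    then show ?thesis by blast
  qed
  have zero: "0 \<in> ?P" by (auto intro!: exI[of _ "[]"])
  have mult: "laurent_eval ls c * laurent_eval ls' c \<in> ?P" if "fst ` set ls \<subseteq> E" "fst ` set ls' \<subseteq> E" for ls ls'
    using that(1)
  proof (induction ls)
    case Nil
    then show ?case using zero by simp
  next
    case (Cons x ls)
    obtain b q where x: "x = (b, q)" by force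
    have "fst ` set (map (\<lambda>(b', q'). (\<lambda>i. b i + b' i, q * q')) ls') \<subseteq> E"
    proof
      fix e assume "e \<in> fst ` set (map (\<lambda>(b', q'). (\<lambda>i. b i + b' i, q * q')) ls')"
      then obtain b' where "b' \<in> fst ` set ls'" "e = (\<lambda>i. b i + b' i)" by force
      moreover have "b \<in> E" using Cons.prems by (simp add: x)
      ultimately show "e \<in> E" using E[of b b'] that(2) by blast
    qed
    then have "of_rat q * laurent_monom c b * laurent_eval ls' c \<in> ?P"
      unfolding monom by blast
    moreover have "laurent_eval ls c * laurent_eval ls' c \<in> ?P" using Cons by auto
    ultimately show ?case using add by (simp only: x laurent_eval_simps distrib_right)
  qed
  have "of_rat q * laurent_eval ls c \<in> ?P" if "fst ` set ls \<subseteq> E" for q ls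
  proof -
    have "fst ` set (map (\<lambda>(b', q'). (b', q * q')) ls) \<subseteq> E" using that by force
    then show ?thesis unfolding scale by blast
  qed
  then have scale': "of_rat q * x \<in> ?P" if "x \<in> ?P" for q x using that by blast
  have mult': "x * y \<in> ?P" if "x \<in> ?P" "y \<in> ?P" for x y using mult that by blast
  have one': "1 \<notin> ?P"
  proof
    assume "1 \<in> ?P"
    then obtain ls where "laurent_eval ls c = 1" "fst ` set ls \<subseteq> E" by force
    with one show False by blast
  qed
  show ?thesis
    unfolding nonunital_subring_def
  proof (intro conjI ballI allI)
    fix x assume x: "x \<in> ?P"
    show "of_rat q * x \<in> ?P" for q by (rule scale'[OF x])
    fix y assume y: "y \<in> ?P"
    show "x + y \<in> ?P" by (rule add[OF x y])
    show "x * y \<in> ?P" by (rule mult'[OF x y])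
  qed (rule zero one')+
qed

section \<open>Linear spaces with integer equations\<close>

text \<open>The points are complex; only the equations are rational.\<close>

definition rat_kernel :: "('i::finite \<Rightarrow> int) set \<Rightarrow> ('i \<Rightarrow> complex) set" where
  "rat_kernel Q = {y. \<forall>a\<in>Q. (\<Sum>i\<in>UNIV. y i * of_int (a i)) = 0}"

lemma generic_point_rat_kernel:
  fixes Q :: "('i::finite \<Rightarrow> int) set"
  obtains c where "c \<in> rat_kernel Q"
    "\<And>ls y. rat_poly_eval ls c = 0 \<Longrightarrow> y \<in> rat_kernel Q \<Longrightarrow> rat_poly_eval ls y = 0"
proof -
  define L where "L = {z::complex^'i. ($) z \<in> rat_kernel Q}"
  have "subspace L"
    unfolding subspace_def L_def rat_kernel_def
    by (auto simp: distrib_right sum.distrib scaleR_conv_of_real[where 'a = complex] mult.assoc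
        simp flip: sum_distrib_left)
  then obtain z where z: "z \<in> L" "\<And>ls y. rat_poly_eval ls (($) z) = 0 \<Longrightarrow> y \<in> L \<Longrightarrow> rat_poly_eval ls (($) y) = 0"
    using generic_point_exists by blast
  show thesis
  proof (rule that[of "($) z"])
    show "($) z \<in> rat_kernel Q" using z by (simp add: L_def)
    fix ls y assume "rat_poly_eval ls (($) z) = 0" "y \<in> rat_kernel Q"
    moreover have "($) (\<chi> i. y i) = y" by (simp add: fun_eq_iff)
    ultimately show "rat_poly_eval ls y = 0"
      using z(2)[of ls "\<chi> i. y i"] by (simp add: L_def)
  qed
qed

text \<open>At \<open>c\<close>, an equation from \<open>Q\<close> becomes a rational relation
  between the independent numbers \<open>c j\<close>, so all its coefficients vanish. Hence the
  \<open>c j\<close> may be varied freely, and the coordinates expanded in them stay in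
  \<open>rat_kernel Q\<close>.\<close>

lemma trop_rat_kernel_of_basis:
  fixes c :: "'i::finite \<Rightarrow> complex" and a :: "'i \<Rightarrow> 'i \<Rightarrow> rat"
  assumes c: "c \<in> rat_kernel Q" and indep: "rat_independent c B"
    and a: "\<And>i. c i = (\<Sum>j\<in>B. of_rat (a i j) * c j)"
    and le: "\<And>i j. j \<in> B \<Longrightarrow> a i j \<noteq> 0 \<Longrightarrow> v i \<le> v j"
    and ex: "\<And>i. \<exists>j\<in>B. a i j \<noteq> 0 \<and> v j = v i"
  shows "v \<in> trop (rat_kernel Q)"
proof (rule trop_of_curve)
  \<comment> \<open>Each basis value \<open>c j\<close> is rescaled by \<open>t powr v j\<close>,
    and every coordinate follows by its rational expansion.\<close>
  define y where "y = (\<lambda>(t::real) i. \<Sum>j\<in>B. of_rat (a i j) * c j * of_real (t powr v j))"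
  show "y t \<in> rat_kernel Q" for t
    unfolding rat_kernel_def
  proof (intro CollectI ballI)
    fix q assume q: "q \<in> Q"
    define e where "e = (\<lambda>j. \<Sum>i\<in>UNIV. a i j * of_int (q i))"
    have sw: "(\<Sum>i\<in>UNIV. (\<Sum>j\<in>B. of_rat (a i j) * f j) * of_int (q i)) = (\<Sum>j\<in>B. of_rat (e j) * f j)"
      for f :: "'i \<Rightarrow> complex"
      unfolding e_def of_rat_sum of_rat_mult sum_distrib_right by (subst sum.swap) (simp add: mult_ac)
    have "(\<Sum>j\<in>B. of_rat (e j) * c j) = 0"
      using c q unfolding sw[symmetric] a[symmetric] by (simp add: rat_kernel_def)
    then have "\<forall>j\<in>B. e j = 0" using indep by (simp add: rat_independent_def)
    then show "(\<Sum>i\<in>UNIV. y t i * of_int (q i)) = 0"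
      by (simp add: y_def mult.assoc[of _ "c _"] sw)
  qed
  \<comment> \<open>The lowest-order coefficient of coordinate \<open>i\<close>: by
    \<open>le\<close> no \<open>v j\<close> in its expansion is below \<open>v i\<close>.
    Independence and \<open>ex\<close> make it nonzero.\<close>
  define l where "l = (\<lambda>i. \<Sum>j\<in>B. of_rat (if v j = v i then a i j else 0) * c j)"
  show "((\<lambda>t. y t i / of_real (t powr v i)) \<longlongrightarrow> l i) (at_right 0)" for i
  proof -
    have "((\<lambda>t. of_rat (a i j) * c j * of_real (t powr (v j - v i))) \<longlongrightarrow>
        of_rat (if v j = v i then a i j else 0) * c j) (at_right 0)" if j: "j \<in> B" for j
    proof -
      consider "a i j = 0" | "v j = v i" | "v i < v j" using le[OF j, of i] by force
      then show ?thesis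
      proof cases
        case 2
        have "eventually (\<lambda>t::real. of_rat (a i j) * c j * of_real (t powr (v j - v i)) = of_rat (a i j) * c j) (at_right 0)"
          using eventually_at_right_less[of "0::real"] by eventually_elim (simp add: 2)
        then show ?thesis using 2 by (simp add: tendsto_eventually)
      next
        case 3
        have "((\<lambda>t. t powr (v j - v i)) \<longlongrightarrow> 0 powr (v j - v i)) (at_right 0)"
          using 3 by (intro tendsto_powr2 tendsto_ident_at tendsto_const
            eventually_mono[OF eventually_at_right_less[of 0]]) auto
        from tendsto_mult[OF tendsto_const[of "of_rat (a i j) * c j"] tendsto_of_real[OF this]]
        show ?thesis using 3 by simp
      qed simp
    qed
    then have "((\<lambda>t. \<Sum>j\<in>B. of_rat (a i j) * c j * of_real (t powr (v j - v i))) \<longlongrightarrow> l i) (at_right 0)"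
      unfolding l_def by (rule tendsto_sum)
    moreover have "eventually (\<lambda>t. (\<Sum>j\<in>B. of_rat (a i j) * c j * of_real (t powr (v j - v i))) =
        y t i / of_real (t powr v i)) (at_right 0)"
      using eventually_at_right_less[of "0::real"]
      by eventually_elim (simp add: y_def sum_divide_distrib powr_diff)
    ultimately show ?thesis by (rule Lim_transform_eventually)
  qed
  show "l i \<noteq> 0" for i
  proof
    assume "l i = 0"
    then have "\<forall>j\<in>B. (if v j = v i then a i j else 0) = 0"
      using indep[unfolded rat_independent_def, THEN spec, of "\<lambda>j. if v j = v i then a i j else 0"]
      unfolding l_def by blast
    then show False using ex[of i] by auto
  qed
qed

lemma trop_torus_orbit_decompose:
  fixes \<rho> :: "nat \<Rightarrow> 'i::finite \<Rightarrow> int"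
  assumes w: "w \<in> trop (torus_orbit \<rho> m (rat_kernel Q))"
  obtains a v where "v \<in> trop (rat_kernel Q)" "w = (\<lambda>i. (\<Sum>j<m. a j * of_int (\<rho> j i)) + v i)"
proof -
  obtain c where c: "c \<in> rat_kernel Q"
    and generic: "\<And>ls y. rat_poly_eval ls c = 0 \<Longrightarrow> y \<in> rat_kernel Q \<Longrightarrow> rat_poly_eval ls y = 0"
    using generic_point_rat_kernel by blast
  \<comment> \<open>By genericity a rational polynomial vanishing at \<open>c\<close> vanishes on
    the whole linear space, and by homogeneity on its orbit, so the tropical condition on
    \<open>w\<close> applies to it.\<close>
  have tie: "\<exists>\<beta>. \<beta> \<noteq> \<alpha> \<and> \<beta> \<in> fst ` set ls \<and> wdeg w \<beta> \<le> wdeg w \<alpha>"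
    if "rat_poly_eval ls c = 0" "list_poly ls \<alpha> \<noteq> 0"
      and hom: "\<And>\<beta> j. \<beta> \<in> fst ` set ls \<Longrightarrow> j < m \<Longrightarrow> (\<Sum>i\<in>UNIV. int (\<beta> i) * \<rho> j i) = d j"
    for ls \<alpha> d
  proof -
    have "list_poly ls \<in> vanishing_ideal (rat_kernel Q)"
      using that(1) generic by (auto simp: vanishing_ideal_def is_poly_list_poly poly_eval_list_poly)
    then have "list_poly ls \<in> vanishing_ideal (torus_orbit \<rho> m (rat_kernel Q))"
      using hom by (intro homogeneous_in_vanishing_ideal_torus_orbit[where d = d])
        (auto dest!: list_poly_support)
    with w that(2) list_poly_support show ?thesis
      unfolding trop_iff by blast
  qed
  \<comment> \<open>Otherwise the variable with index \<open>i\<close>, which is homogeneous with a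
    single term, would vanish at \<open>c\<close>, and \<open>tie\<close> would demand a second
    term.\<close>
  have nz: "c i \<noteq> 0" for i
  proof
    assume "c i = 0"
    define \<epsilon> where "\<epsilon> = (\<lambda>l. if l = i then 1 else 0::nat)"
    have "(\<Prod>l\<in>UNIV. c l ^ \<epsilon> l) = 0"
      using \<open>c i = 0\<close> by (intro prod_zero) (auto simp: \<epsilon>_def intro!: bexI[of _ i])
    then show False
      using tie[of "[(\<epsilon>, 1)]" \<epsilon> "\<lambda>j. \<Sum>i\<in>UNIV. int (\<epsilon> i) * \<rho> j i"]
      by (auto simp: rat_poly_eval_def list_poly_def)
  qed
  \<comment> \<open>Exponents of Laurent monomials of multidegree zero and positive
    \<open>w\<close>-weight: these monomials are to become non-units of the valuation ring.\<close>
  define E where "E = {b. (\<forall>j<m. (\<Sum>i\<in>UNIV. b i * \<rho> j i) = 0) \<and> 0 < lin b w}"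
  have "nonunital_subring {laurent_eval ls c | ls. fst ` set ls \<subseteq> E}"
  proof (rule laurent_span_nonunital_subring)
    show "c i \<noteq> 0" for i by (rule nz)
    show "(\<lambda>i. b i + b' i) \<in> E" if "b \<in> E" "b' \<in> E" for b b'
      using that by (auto simp: E_def lin_add_left sum.distrib distrib_right)
    show "laurent_eval ls c \<noteq> 1" if E: "fst ` set ls \<subseteq> E" for ls
    proof
      assume 1: "laurent_eval ls c = 1"
      \<comment> \<open>Large enough that \<open>\<delta> + b\<close> is nonnegative for every
        exponent \<open>b\<close> of \<open>ls\<close>, so its monomial clears all
        denominators.\<close>
      define \<delta> where "\<delta> = (\<lambda>i. \<Sum>b\<in>fst ` set ls. nat \<bar>b i\<bar>)"
      define sh where "sh = (\<lambda>b i. nat (int (\<delta> i) + b i))"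
      have sh: "int (sh b i) = int (\<delta> i) + b i" if "b \<in> fst ` set ls" for b i
      proof -
        have "nat \<bar>b i\<bar> \<le> \<delta> i"
          unfolding \<delta>_def using that by (intro member_le_sum) auto
        then show ?thesis by (simp add: sh_def)
      qed
      have wdeg_sh: "wdeg w (sh b) = wdeg w \<delta> + lin b w" if "b \<in> fst ` set ls" for b
      proof -
        have "real (sh b i) = real (\<delta> i) + of_int (b i)" for i
          using arg_cong[OF sh[OF that, of i], of real_of_int] by simp
        then show ?thesis by (simp add: wdeg_def lin_def distrib_right sum.distrib)
      qed
      \<comment> \<open>With \<open>(\<delta>, 1)\<close> in front, this is the relation
        \<open>laurent_eval ls c = 1\<close> times the monomial of \<delta>, brought to one side. It
        is homogeneous, and \<delta> is a strict minimum because \<open>0 < lin b w\<close> on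
        \<open>E\<close>, which contradicts \<open>tie\<close>.\<close>
      define sls where "sls = map (\<lambda>(b, q). (sh b, - q)) ls"
      have fst_sls: "fst ` set sls = sh ` fst ` set ls"
        by (force simp: sls_def)
      have "rat_poly_eval (map (\<lambda>(b, q). (sh b, - q)) ks) c = - ((\<Prod>i\<in>UNIV. c i ^ \<delta> i) * laurent_eval ks c)"
        if "fst ` set ks \<subseteq> fst ` set ls" for ks
        using that
      proof (induction ks)
        case Nil
        then show ?case by (simp add: rat_poly_eval_def)
      next
        case (Cons x ks)
        obtain b q where x: "x = (b, q)" by force
        then have b: "b \<in> fst ` set ls" using Cons.prems by auto
        have "c i ^ sh b i = c i ^ \<delta> i * c i powi b i" for i
          using arg_cong[OF sh[OF b, of i], of "(powi) (c i)"] nz by (simp add: power_int_add)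
        then have "(\<Prod>i\<in>UNIV. c i ^ sh b i) = (\<Prod>i\<in>UNIV. c i ^ \<delta> i) * laurent_monom c b"
          by (simp add: laurent_monom_def prod.distrib)
        then show ?case
          using Cons by (simp add: rat_poly_eval_def x of_rat_minus algebra_simps)
      qed
      then have "rat_poly_eval ((\<delta>, 1) # sls) c = 0"
        using 1 by (simp add: sls_def rat_poly_eval_def)
      moreover have "list_poly ((\<delta>, 1) # sls) \<delta> \<noteq> 0"
      proof -
        have "\<delta> \<notin> fst ` set sls"
          unfolding fst_sls using wdeg_sh E by (fastforce simp: E_def)
        then have "list_poly sls \<delta> = 0" using list_poly_support by blast
        moreover have "list_poly ((\<delta>, 1) # sls) \<delta> = 1 + list_poly sls \<delta>"
          by (simp add: list_poly_def)
        ultimately show ?thesis by simp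
      qed
      moreover have "(\<Sum>i\<in>UNIV. int (\<beta> i) * \<rho> j i) = (\<Sum>i\<in>UNIV. int (\<delta> i) * \<rho> j i)"
        if \<beta>: "\<beta> \<in> fst ` set ((\<delta>, 1) # sls)" and "j < m" for \<beta> j
      proof (cases "\<beta> = \<delta>")
        case False
        then obtain b where b: "b \<in> fst ` set ls" "\<beta> = sh b"
          using \<beta> fst_sls by auto
        then have "(\<Sum>i\<in>UNIV. b i * \<rho> j i) = 0" using E \<open>j < m\<close> by (auto simp: E_def)
        then show ?thesis by (simp add: b(2) sh[OF b(1)] distrib_right sum.distrib)
      qed simp
      ultimately obtain \<beta> where "\<beta> \<noteq> \<delta>" "\<beta> \<in> fst ` set ((\<delta>, 1) # sls)" "wdeg w \<beta> \<le> wdeg w \<delta>"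
        using tie[of "(\<delta>, 1) # sls" \<delta> "\<lambda>j. \<Sum>i\<in>UNIV. int (\<delta> i) * \<rho> j i"] by blast
      then obtain b where "b \<in> fst ` set ls" "wdeg w (sh b) \<le> wdeg w \<delta>"
        using fst_sls by auto
      then show False using wdeg_sh[of b] E by (auto simp: E_def)
    qed
  qed
  then obtain R where add: "\<And>x y. x \<in> R \<Longrightarrow> y \<in> R \<Longrightarrow> x + y \<in> R"
    and mult: "\<And>x y. x \<in> R \<Longrightarrow> y \<in> R \<Longrightarrow> x * y \<in> R"
    and rat: "\<And>q. of_rat q \<in> R"
    and valuation: "\<And>x. x \<noteq> 0 \<Longrightarrow> x \<in> R \<or> inverse x \<in> R"
    and nonunit: "\<And>x. x \<in> {laurent_eval ls c | ls. fst ` set ls \<subseteq> E} \<Longrightarrow> x \<noteq> 0 \<Longrightarrow> inverse x \<notin> R"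
    by (rule valuation_ring_exists) blast
  have sum_R: "(\<And>j. j \<in> A \<Longrightarrow> f j \<in> R) \<Longrightarrow> sum f A \<in> R" for A and f :: "'i \<Rightarrow> complex"
    using add rat[of 0] by (induction A rule: infinite_finite_induct) auto
  \<comment> \<open>Exponents whose monomial has nonnegative valuation; they form a semigroup, as
    the Farkas lemma requires.\<close>
  define N where "N = {b. laurent_monom c b \<in> R}"
  \<comment> \<open>Negative weight would put \<open>- b\<close> into \<open>E\<close>, but the
    monomials of \<open>E\<close> have no inverse in \<open>R\<close>.\<close>
  have N_nonneg: "0 \<le> lin b w" if "b \<in> N" "\<And>j. j < m \<Longrightarrow> (\<Sum>i\<in>UNIV. b i * \<rho> j i) = 0" for b
  proof (rule ccontr)
    assume "\<not> 0 \<le> lin b w"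
    moreover have "lin (\<lambda>i. - b i) w = - lin b w" by (simp add: lin_def sum_negf)
    ultimately have "(\<lambda>i. - b i) \<in> E" using that(2) by (simp add: E_def sum_negf)
    then have "fst ` set [(\<lambda>i. - b i, 1::rat)] \<subseteq> E"
      "laurent_monom c (\<lambda>i. - b i) = laurent_eval [(\<lambda>i. - b i, 1)] c" by simp_all
    then have "inverse (laurent_monom c (\<lambda>i. - b i)) \<notin> R"
      by (intro nonunit laurent_monom_nonzero nz) blast
    then show False using that(1) by (simp add: laurent_monom_uminus N_def)
  qed
  \<comment> \<open>\<open>le i j\<close> says that the valuation of \<open>c i\<close> is at most
    that of \<open>c j\<close>.\<close>
  define le where "le = (\<lambda>i j. c j / c i \<in> R)"
  have total: "le i j \<or> le j i" for i j
    using valuation[of "c j / c i"] nz by (simp add: le_def)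
  have trans: "le i j \<Longrightarrow> le j l \<Longrightarrow> le i l" for i j l
    using mult[of "c j / c i" "c l / c j"] nz by (simp add: le_def)
  obtain B where indep: "rat_independent c B"
    and "\<And>i. \<exists>a. c i = (\<Sum>j\<in>B. of_rat (a j) * c j) \<and> (\<forall>j\<in>B. a j \<noteq> 0 \<longrightarrow> le i j)"
    using ordered_rat_basis[of "UNIV::'i set" le c] total trans by auto
  then obtain a where a: "\<And>i. c i = (\<Sum>j\<in>B. of_rat (a i j) * c j)"
    and a_le: "\<And>i j. j \<in> B \<Longrightarrow> a i j \<noteq> 0 \<Longrightarrow> le i j"
    by metis
  \<comment> \<open>The exponent vector of \<open>c j / c i\<close>. For \<open>i = j\<close> the
    entries 1 and -1 would fall on the same index, hence the separate case.\<close>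
  define u where "u = (\<lambda>(i::'i) j l. if i = j then 0 else if l = j then 1 else if l = i then - 1 else 0 :: int)"
  have lin_u: "lin (u i j) v = v j - v i" for i j v
  proof (cases "i = j")
    case False
    then have "lin (u i j) v = (\<Sum>l\<in>UNIV. (if l = j then v l else 0) - (if l = i then v l else 0))"
      unfolding lin_def by (intro sum.cong) (auto simp: u_def)
    then show ?thesis by (simp add: sum_subtractf)
  qed (simp add: u_def lin_def)
  have monom_u: "laurent_monom c (u i j) = c j / c i" for i j
  proof (cases "i = j")
    case False
    then have "laurent_monom c (u i j) = (\<Prod>l\<in>UNIV. (if l = j then c l else 1) * (if l = i then inverse (c l) else 1))"
      unfolding laurent_monom_def by (intro prod.cong) (auto simp: u_def)
    then show ?thesis by (simp add: prod.distrib divide_inverse)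
  qed (simp add: u_def laurent_monom_def nz)
  define G where "G = {u i j | i j. le i j}"
  have "finite G"
    by (rule finite_subset[of _ "case_prod u ` UNIV"]) (auto simp: G_def)
  have "G \<subseteq> N" by (auto simp: G_def N_def le_def monom_u)
  have N_add: "(\<lambda>i. b i + b' i) \<in> N" if "b \<in> N" "b' \<in> N" for b b'
    using that mult by (simp add: N_def laurent_monom_add nz)
  \<comment> \<open>Farkas shifts \<open>w\<close> by a combination of the rows so that the result
    respects all of the finitely many comparisons in \<open>le\<close>.\<close>
  obtain a' where a': "\<And>g. g \<in> G \<Longrightarrow> 0 \<le> lin g (\<lambda>i. w i + (\<Sum>j<m. a' j * of_int (\<rho> j i)))"
    using farkas_integral[OF N_add N_nonneg \<open>finite G\<close> \<open>G \<subseteq> N\<close>] by blast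
  define v where "v = (\<lambda>i. w i + (\<Sum>j<m. a' j * of_int (\<rho> j i)))"
  have v_le: "v i \<le> v j" if "le i j" for i j
  proof -
    have "u i j \<in> G" using that by (auto simp: G_def)
    from a'[OF this] show ?thesis by (simp add: lin_u v_def)
  qed
  \<comment> \<open>A \<open>le\<close>-least \<open>j\<close> in the support of the expansion of
    \<open>c i\<close> has the same valuation as \<open>c i\<close>: after division by
    \<open>c j\<close> all summands lie in \<open>R\<close>. Comparability in both directions forces
    \<open>v j = v i\<close>.\<close>
  have "\<exists>j\<in>B. a i j \<noteq> 0 \<and> v j = v i" for i
  proof -
    define S where "S = {j \<in> B. a i j \<noteq> 0}"
    have "S \<noteq> {}"
    proof
      assume "S = {}"
      then have "(\<Sum>j\<in>B. of_rat (a i j) * c j) = 0" by (intro sum.neutral) (auto simp: S_def)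
      then show False using a nz by metis
    qed
    then obtain j where j: "j \<in> S" "\<And>l. l \<in> S \<Longrightarrow> le j l"
      using total_preorder_least[of S le] total trans by auto
    have "c i / c j = (\<Sum>l\<in>B. of_rat (a i l) * (c l / c j))"
      by (subst a) (simp add: sum_divide_distrib)
    also have "\<dots> \<in> R"
    proof (rule sum_R)
      fix l assume "l \<in> B"
      then show "of_rat (a i l) * (c l / c j) \<in> R"
        using j(2)[of l] mult[OF rat, of "c l / c j"] rat[of 0]
        by (cases "a i l = 0") (auto simp: S_def le_def)
    qed
    finally have "le j i" by (simp add: le_def)
    moreover have "le i j" using j a_le by (simp add: S_def)
    ultimately have "v j = v i" using v_le by (meson order_antisym)
    then show ?thesis using j by (auto simp: S_def)
  qed
  then have "v \<in> trop (rat_kernel Q)"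
    using trop_rat_kernel_of_basis[OF c indep a] a_le v_le by blast
  moreover have "w = (\<lambda>i. (\<Sum>j<m. (- a' j) * of_int (\<rho> j i)) + v i)"
    by (simp add: v_def sum_negf)
  ultimately show thesis by (rule that[of v "\<lambda>j. - a' j"])
qed

theorem trop_torus_orbit:
  fixes \<rho> :: "nat \<Rightarrow> 'i::finite \<Rightarrow> int"
  shows "trop (torus_orbit \<rho> m (rat_kernel Q)) =
    {(\<lambda>i. (\<Sum>j<m. a j * of_int (\<rho> j i)) + v i) | a v. v \<in> trop (rat_kernel Q)}"
proof (intro equalityI subsetI)
  fix w assume "w \<in> trop (torus_orbit \<rho> m (rat_kernel Q))"
  then show "w \<in> {(\<lambda>i. (\<Sum>j<m. a j * of_int (\<rho> j i)) + v i) | a v. v \<in> trop (rat_kernel Q)}"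
    by (rule trop_torus_orbit_decompose) blast
next
  fix w assume "w \<in> {(\<lambda>i. (\<Sum>j<m. a j * of_int (\<rho> j i)) + v i) | a v. v \<in> trop (rat_kernel Q)}"
  then obtain a v where "v \<in> trop (rat_kernel Q)"
    and w: "w = (\<lambda>i. (\<Sum>j<m. a j * of_int (\<rho> j i)) + v i)" by blast
  then show "w \<in> trop (torus_orbit \<rho> m (rat_kernel Q))"
    unfolding w by (intro trop_add_character[OF _ subset_torus_orbit] torus_orbit_stable)
qed

section \<open>Application to the dual variety\<close>

text \<open>The characters are the rows of \<open>A\<close>, with the row of ones at index
  \<open>n\<close>. That last factor only scales, which the linear kernel absorbs; the other factors
  are the inverses of the coordinates of the osculation point.\<close>

lemma osc_hyperplanes_eq_torus_orbit:
  "osc_hyperplanes r n k = torus_orbit (\<lambda>j i. if j < n then r i j else 1) (Suc n) (ker_Ak r n k)"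
proof (intro equalityI subsetI)
  fix c assume "c \<in> osc_hyperplanes r n k"
  then obtain x where x: "x \<in> torus n" and y: "(\<lambda>i. c i * (\<Prod>j<n. x j powi r i j)) \<in> ker_Ak r n k"
    by (auto simp: osc_hyperplanes_iff)
  define s where "s = (\<lambda>j. if j < n then inverse (x j) else 1)"
  have "(\<Prod>j<n. x j powi r i j) * (\<Prod>j<n. s j powi r i j) = 1" for i
    using x by (simp add: s_def torus_def power_int_inverse flip: prod.distrib)
  then have "c = (\<lambda>i. c i * (\<Prod>j<n. x j powi r i j) * (\<Prod>j<Suc n. s j powi (if j < n then r i j else 1)))"
    by (simp add: s_def mult.assoc)
  moreover have "\<forall>j<Suc n. s j \<noteq> 0" using x by (auto simp: s_def torus_def)
  ultimately show "c \<in> torus_orbit (\<lambda>j i. if j < n then r i j else 1) (Suc n) (ker_Ak r n k)"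
    unfolding torus_orbit_def mem_Collect_eq using y
    by (intro exI[of _ "\<lambda>i. c i * (\<Prod>j<n. x j powi r i j)"] exI[of _ s] conjI)
next
  fix c assume "c \<in> torus_orbit (\<lambda>j i. if j < n then r i j else 1) (Suc n) (ker_Ak r n k)"
  then obtain y s where y: "y \<in> ker_Ak r n k" and s: "\<forall>j<Suc n. s j \<noteq> 0"
    and c: "c = (\<lambda>i. y i * (\<Prod>j<Suc n. s j powi (if j < n then r i j else 1)))"
    by (auto simp: torus_orbit_def)
  have "(\<Prod>j<n. s j powi r i j) * (\<Prod>j<n. inverse (s j) powi r i j) = 1" for i
    using s by (simp add: power_int_inverse flip: prod.distrib)
  then have "(\<lambda>i. c i * (\<Prod>j<n. inverse (s j) powi r i j)) = (\<lambda>i. s n * y i)"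
    by (simp add: c fun_eq_iff mult_ac)
  also have "\<dots> \<in> ker_Ak r n k"
    using y by (simp add: ker_Ak_def mult.assoc flip: sum_distrib_left)
  finally show "c \<in> osc_hyperplanes r n k"
    unfolding osc_hyperplanes_iff using s
    by (intro bexI[of _ "\<lambda>j. inverse (s j)"]) (auto simp: torus_def)
qed

lemma ker_Ak_eq_rat_kernel: "ker_Ak r n k = rat_kernel ((\<lambda>\<beta> i. \<Prod>j<n. r i j ^ \<beta> j) ` multi_idx n k)"
  by (auto simp: ker_Ak_def rat_kernel_def)

lemma rowspan_A_eq:
  "rowspan_A r n = {(\<lambda>i. \<Sum>j<Suc n. a j * of_int (if j < n then r i j else 1)) | a. True}"
proof (intro equalityI subsetI)
  fix u assume "u \<in> rowspan_A r n"
  then obtain a0 a where u: "u = (\<lambda>i. a0 + (\<Sum>j<n. a j * of_int (r i j)))" by (auto simp: rowspan_A_def)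
  \<comment> \<open>The coefficient of the row of ones is stored at index \<open>n\<close>.\<close>
  have "u = (\<lambda>i. \<Sum>j<Suc n. (a(n := a0)) j * of_int (if j < n then r i j else 1))"
    by (simp add: u add.commute)
  then show "u \<in> {(\<lambda>i. \<Sum>j<Suc n. a j * of_int (if j < n then r i j else 1)) | a. True}" by blast
next
  fix u :: "'a \<Rightarrow> real" assume "u \<in> {(\<lambda>i. \<Sum>j<Suc n. a j * of_int (if j < n then r i j else 1)) | a. True}"
  then obtain a where u: "u = (\<lambda>i. \<Sum>j<Suc n. a j * of_int (if j < n then r i j else 1))" by blast
  show "u \<in> rowspan_A r n"
    unfolding rowspan_A_def mem_Collect_eq
    by (intro exI[of _ "a n"] exI[of _ a]) (simp add: u add.commute)
qed

theorem theorem5p2: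
  fixes r :: "'i::finite \<Rightarrow> nat \<Rightarrow> int" and n k :: nat
  assumes coords: "\<And>i j. j \<ge> n \<Longrightarrow> r i j = 0"
    and distinct: "inj r"
    and spans: "lattice_span r = Zn n"
    and k: "k \<ge> 1"
  shows "trop (dual_cone r n k) = {(\<lambda>i. u i + v i) | u v. u \<in> rowspan_A r n \<and> v \<in> trop (ker_Ak r n k)}
     \<and> proj_class ` trop (dual_cone r n k) = trop_dual_variety r n k"
proof
  have "trop (dual_cone r n k) = {(\<lambda>i. (\<Sum>j<Suc n. a j * of_int (if j < n then r i j else 1)) + v i) | a v.
      v \<in> trop (ker_Ak r n k)}"
    \<comment> \<open>Zariski closure leaves the vanishing ideal unchanged, so the result on torus
      orbits applies to the set of osculating hyperplanes itself.\<close>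
    unfolding dual_cone_def trop_zariski_closure osc_hyperplanes_eq_torus_orbit ker_Ak_eq_rat_kernel
    by (rule trop_torus_orbit)
  also have "\<dots> = {(\<lambda>i. u i + v i) | u v. u \<in> rowspan_A r n \<and> v \<in> trop (ker_Ak r n k)}"
  proof (intro Collect_cong iffI; elim exE conjE)
    fix w a v assume "w = (\<lambda>i. (\<Sum>j<Suc n. a j * of_int (if j < n then r i j else 1)) + v i)"
      and "v \<in> trop (ker_Ak r n k)"
    then show "\<exists>u v. w = (\<lambda>i. u i + v i) \<and> u \<in> rowspan_A r n \<and> v \<in> trop (ker_Ak r n k)"
      unfolding rowspan_A_eq
      by (intro exI[of _ "\<lambda>i. \<Sum>j<Suc n. a j * of_int (if j < n then r i j else 1)"] exI[of _ v]) blast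
  next
    fix w u v assume w: "w = (\<lambda>i. u i + v i)" and "u \<in> rowspan_A r n" and v: "v \<in> trop (ker_Ak r n k)"
    then obtain a where "u = (\<lambda>i. \<Sum>j<Suc n. a j * of_int (if j < n then r i j else 1))"
      unfolding rowspan_A_eq by blast
    with w v show "\<exists>a v. w = (\<lambda>i. (\<Sum>j<Suc n. a j * of_int (if j < n then r i j else 1)) + v i)
        \<and> v \<in> trop (ker_Ak r n k)"
      by (intro exI[of _ a] exI[of _ v]) simp
  qed
  finally show "trop (dual_cone r n k) = {(\<lambda>i. u i + v i) | u v. u \<in> rowspan_A r n \<and> v \<in> trop (ker_Ak r n k)}" .
  \<comment> \<open>The tropicalization of a projective variety is defined as the image of that of
    its cone.\<close>
  show "proj_class ` trop (dual_cone r n k) = trop_dual_variety r n k"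
    by (simp add: trop_dual_variety_def trop_proj_def)
qed

end
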